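(* Let $k\ge2$ and $1\le i\le k-1$. For every $n\ge0$, $\overline{B}_{k,i}(n)+\overline{B}_{k,i+1}(n)$ equals the number of superpartitions of $n$ whose non-overlined parts are not congruent to $0,\pm i$ modulo $2k$.
   Context: An overpartition of $n$ is a non-increasing sequence of positive integers summing to $n$ in which the final occurrence of each value may be overlined. For $1\le i\le k$, $\overline{B}_{k,i}(n)$ is the number of overpartitions $(\lambda_1,\dots,\lambda_s)$ of $n$ such that $\lambda_\ell-\lambda_{\ell+k-1}\ge1$ if $\lambda_{\ell+k-1}$ is overlined and $\lambda_\ell-\lambda_{\ell+k-1}\ge2$ otherwise (for all $\ell$ with $\ell+k-1\le s$), and at most $i-1$ parts are equal to $1$. A superpartition of $n$ is like an overpartition except that the first occurrence of a part may be overlined and the part $\overline{0}$ may appear (at most once); non-overlined parts are positive integers, overlined parts are distinct nonnegative integers, and all parts sum to $n$. *)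

theory Defs
  imports "HOL-Number_Theory.Cong"
begin

datatype part = Part (size_of: nat) (overlined: bool)

definition parts_sum :: "part list \<Rightarrow> nat"
  where "parts_sum xs = sum_list (map size_of xs)"

definition nonincreasing :: "part list \<Rightarrow> bool"
  where "nonincreasing xs \<longleftrightarrow> sorted_wrt (\<ge>) (map size_of xs)"

text \<open>Overpartitions: only the final occurrence of a value may be overlined.\<close>

definition overpartition :: "nat \<Rightarrow> part list \<Rightarrow> bool" where
  "overpartition n xs \<longleftrightarrow>
     nonincreasing xs \<and> parts_sum xs = n \<and>
     (\<forall>p\<in>set xs. size_of p > 0) \<and>
     (\<forall>j<length xs. overlined (xs ! j) \<longrightarrow>
        (\<forall>m. j < m \<and> m < length xs \<longrightarrow> size_of (xs ! m) \<noteq> size_of (xs ! j)))"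

text \<open>Superpartitions: only the first occurrence of a value may be overlined, and the
  value 0 occurs only overlined. Hence it occurs at most once.\<close>

definition superpartition :: "nat \<Rightarrow> part list \<Rightarrow> bool" where
  "superpartition n xs \<longleftrightarrow>
     nonincreasing xs \<and> parts_sum xs = n \<and>
     (\<forall>p\<in>set xs. \<not> overlined p \<longrightarrow> size_of p > 0) \<and>
     (\<forall>j<length xs. overlined (xs ! j) \<longrightarrow>
        (\<forall>m<j. size_of (xs ! m) \<noteq> size_of (xs ! j)))"

text \<open>Indices are 0-based. The count of parts equal to 1 includes an overlined 1.\<close>

definition Bset :: "nat \<Rightarrow> nat \<Rightarrow> nat \<Rightarrow> part list set" where
  "Bset k i n = {xs. overpartition n xs \<and>
     (\<forall>l. l + k - 1 < length xs \<longrightarrow>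
        int (size_of (xs ! l)) - int (size_of (xs ! (l + k - 1)))
          \<ge> (if overlined (xs ! (l + k - 1)) then 1 else 2)) \<and>
     length (filter (\<lambda>p. size_of p = 1) xs) \<le> i - 1}"

definition Bbar :: "nat \<Rightarrow> nat \<Rightarrow> nat \<Rightarrow> nat"
  where "Bbar k i n = card (Bset k i n)"

text \<open>Finiteness, so that the cardinalities above and in the theorem are genuine counts.\<close>

lemma length_le_sum_list:
  "(\<forall>x\<in>set xs. (0::nat) < x) \<Longrightarrow> length xs \<le> sum_list xs"
  by (induction xs) auto

lemma finite_parts_bounded:
  "finite {xs. (\<forall>p\<in>set xs. size_of p \<le> n) \<and> length xs \<le> m}"
proof -
  have "finite ((\<lambda>(a, b). Part a b) ` ({..n} \<times> UNIV))" by simp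
  moreover have "{p. size_of p \<le> n} \<subseteq> (\<lambda>(a, b). Part a b) ` ({..n} \<times> UNIV)"
  proof
    fix p assume "p \<in> {p. size_of p \<le> n}"
    then show "p \<in> (\<lambda>(a, b). Part a b) ` ({..n} \<times> UNIV)" by (cases p) auto
  qed
  ultimately have "finite {p. size_of p \<le> n}" by (rule rev_finite_subset)
  from finite_lists_length_le[OF this, of m] show ?thesis
    by (rule rev_finite_subset) auto
qed

lemma size_of_le_parts_sum: "p \<in> set xs \<Longrightarrow> size_of p \<le> parts_sum xs"
  by (induction xs) (auto simp: parts_sum_def)

lemma finite_overpartitions: "finite {xs. overpartition n xs}"
proof (rule finite_subset[OF _ finite_parts_bounded[of n n]], safe)
  fix xs assume o: "overpartition n xs"
  show "length xs \<le> n"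
    using o length_le_sum_list[of "map size_of xs"]
    by (auto simp: overpartition_def parts_sum_def)
  fix p assume "p \<in> set xs"
  then show "size_of p \<le> n" using o size_of_le_parts_sum by (auto simp: overpartition_def)
qed

lemma finite_Bset: "finite (Bset k i n)"
  by (rule finite_subset[OF _ finite_overpartitions[of n]]) (auto simp: Bset_def)

lemma finite_superpartitions: "finite {xs. superpartition n xs}"
proof (rule finite_subset[OF _ finite_parts_bounded[of n "Suc n"]], safe)
  fix xs assume s: "superpartition n xs"
  have pos: "size_of (xs ! j) > 0" if j: "j < length xs - 1" for j
  proof (rule ccontr)
    assume "\<not> size_of (xs ! j) > 0"
    moreover have "size_of (xs ! (length xs - 1)) \<le> size_of (xs ! j)"
      using s j by (auto simp: superpartition_def nonincreasing_def sorted_wrt_iff_nth_less)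
    ultimately have z: "size_of (xs ! j) = 0" "size_of (xs ! (length xs - 1)) = 0" by auto
    have l: "length xs - 1 < length xs" using j by simp
    then have "overlined (xs ! (length xs - 1))"
      using s z(2) by (metis superpartition_def nth_mem less_irrefl)
    then show False using s z l j by (metis superpartition_def)
  qed
  have "\<forall>x\<in>set (map size_of (butlast xs)). 0 < x"
    using pos by (auto simp: in_set_conv_nth nth_butlast)
  from length_le_sum_list[OF this]
  have "length (butlast xs) \<le> sum_list (map size_of (butlast xs))" by simp
  also have "\<dots> \<le> parts_sum xs"
    by (cases xs rule: rev_cases) (auto simp: parts_sum_def)
  finally show "length xs \<le> Suc n" using s by (simp add: superpartition_def)
  fix p assume "p \<in> set xs"
  then show "size_of p \<le> n" using s size_of_le_parts_sum by (auto simp: superpartition_def)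
qed

end

theory Submission
  imports Defs "HOL-Computational_Algebra.Formal_Power_Series"
begin

text \<open>
  Let \<open>G\<^sub>i(m)\<close> be the generating function of the overpartitions counted by \<open>Bbar k i\<close> with the
  restriction on the smallest value moved from 1 to \<open>m + 1\<close>. In terms of multiplicities the
  condition on windows of length \<open>k\<close> bounds the non-overlined copies of \<open>v\<close> plus all copies of
  \<open>v + 1\<close> by \<open>k - 1\<close>, so removing the smallest value gives a recurrence. For
  \<open>H\<^sub>i = G\<^sub>i + G\<^sub>i\<^sub>+\<^sub>1\<close>, with \<open>H\<^sub>0 = 0\<close> and \<open>H\<^sub>k = 2 G\<^sub>k\<close>, it becomes Andrews'
  \<open>H\<^sub>i(m) - H\<^sub>i\<^sub>-\<^sub>1(m) = q\<^bsup>(m+1)(i-1)\<^esup> H\<^sub>k\<^sub>-\<^sub>i\<^sub>+\<^sub>1(m+1) + q\<^bsup>(m+1)i\<^esup> H\<^sub>k\<^sub>-\<^sub>i(m+1)\<close>.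
  Since \<open>H\<^sub>i(m)\<close> tends to 2, this has a unique solution, which is an explicit theta-like series;
  at \<open>m = 0\<close> the Jacobi triple product turns it into the product counting the superpartitions.
  All limits are taken modulo powers of \<open>q\<close>, so only finite sums and products occur.
\<close>

unbundle fps_syntax

section \<open>Generating functions of sets of part lists\<close>

text \<open>\<open>card\<close> is 0 on infinite sets, so generating functions of disjoint sets add
  up only under this condition.\<close>

definition finitely_many_per_sum :: "part list set \<Rightarrow> bool" where
  "finitely_many_per_sum A \<longleftrightarrow> (\<forall>n. finite {xs \<in> A. parts_sum xs = n})"

text \<open>Coefficients lie in a field so that series with nonzero constant term can be
  inverted.\<close>

definition gen_fun :: "part list set \<Rightarrow> real fps" where
  "gen_fun A = Abs_fps (\<lambda>n. real (card {xs \<in> A. parts_sum xs = n}))"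

lemma gen_fun_nth: "gen_fun A $ n = real (card {xs \<in> A. parts_sum xs = n})"
  by (simp add: gen_fun_def)

lemma parts_sum_simps [simp]:
  "parts_sum [] = 0"
  "parts_sum (p # xs) = size_of p + parts_sum xs"
  "parts_sum (xs @ ys) = parts_sum xs + parts_sum ys"
  "parts_sum (replicate j p) = j * size_of p"
  by (auto simp: parts_sum_def sum_list_replicate)

lemma finitely_many_per_sum_mono:
  assumes "finitely_many_per_sum B" "A \<subseteq> B"
  shows "finitely_many_per_sum A"
  unfolding finitely_many_per_sum_def
proof
  fix n
  have "{xs \<in> A. parts_sum xs = n} \<subseteq> {xs \<in> B. parts_sum xs = n}" using assms(2) by blast
  then show "finite {xs \<in> A. parts_sum xs = n}"
    using assms(1) finite_subset unfolding finitely_many_per_sum_def by blast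
qed

lemma gen_fun_empty [simp]: "gen_fun {} = 0"
  by (simp add: fps_eq_iff gen_fun_nth)

lemma gen_fun_union:
  assumes "finitely_many_per_sum A" "finitely_many_per_sum B" "A \<inter> B = {}"
  shows "gen_fun (A \<union> B) = gen_fun A + gen_fun B"
proof (rule fps_ext)
  fix n
  have "{xs \<in> A \<union> B. parts_sum xs = n} = {xs \<in> A. parts_sum xs = n} \<union> {xs \<in> B. parts_sum xs = n}"
    by auto
  moreover have "card ({xs \<in> A. parts_sum xs = n} \<union> {xs \<in> B. parts_sum xs = n}) =
      card {xs \<in> A. parts_sum xs = n} + card {xs \<in> B. parts_sum xs = n}"
    using assms by (intro card_Un_disjoint) (auto simp: finitely_many_per_sum_def)
  ultimately show "gen_fun (A \<union> B) $ n = (gen_fun A + gen_fun B) $ n"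
    by (simp only: gen_fun_nth fps_add_nth of_nat_add)
qed

lemma gen_fun_union3:
  assumes "S = A \<union> (B \<union> C)" "finitely_many_per_sum S" "A \<inter> (B \<union> C) = {}" "B \<inter> C = {}"
  shows "gen_fun S = gen_fun A + (gen_fun B + gen_fun C)"
proof -
  have fin: "finitely_many_per_sum A" "finitely_many_per_sum (B \<union> C)"
    "finitely_many_per_sum B" "finitely_many_per_sum C"
    using finitely_many_per_sum_mono[OF assms(2)] assms(1) by auto
  show ?thesis
    unfolding assms(1) gen_fun_union[OF fin(1,2) assms(3)] gen_fun_union[OF fin(3,4) assms(4)] ..
qed

text \<open>The smallest parts of a nonincreasing list stand at its end, so recurrences arise from
  appending a fixed tail \<open>zs\<close>. This is injective and adds a constant to the
  sum.\<close>

lemma gen_fun_append: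
  "gen_fun ((\<lambda>ys. ys @ zs) ` A) = fps_X ^ parts_sum zs * gen_fun A"
proof (rule fps_ext)
  fix n
  let ?w = "parts_sum zs"
  have "{xs \<in> (\<lambda>ys. ys @ zs) ` A. parts_sum xs = n} =
      (\<lambda>ys. ys @ zs) ` {ys \<in> A. ?w \<le> n \<and> parts_sum ys = n - ?w}"
    by auto
  moreover have "inj_on (\<lambda>ys. ys @ zs) S" for S :: "part list set"
    by (auto simp: inj_on_def)
  ultimately have "card {xs \<in> (\<lambda>ys. ys @ zs) ` A. parts_sum xs = n} =
      card {ys \<in> A. ?w \<le> n \<and> parts_sum ys = n - ?w}"
    by (simp add: card_image)
  then show "gen_fun ((\<lambda>ys. ys @ zs) ` A) $ n = (fps_X ^ ?w * gen_fun A) $ n"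
    by (auto simp: gen_fun_nth fps_X_power_mult_nth not_less)
qed

text \<open>Divisibility of a difference by \<open>fps_X ^ N\<close> serves as congruence modulo q^N
  and replaces convergence throughout.\<close>

lemma fps_X_power_dvd_iff_nth:
  fixes f :: "real fps"
  shows "fps_X ^ N dvd f \<longleftrightarrow> (\<forall>n<N. f $ n = 0)"
proof
  assume "fps_X ^ N dvd f"
  then show "\<forall>n<N. f $ n = 0" by (auto simp: dvd_def fps_X_power_mult_nth)
next
  assume *: "\<forall>n<N. f $ n = 0"
  have "f = fps_X ^ N * fps_shift N f"
    using * by (auto simp: fps_eq_iff fps_X_power_mult_nth)
  then show "fps_X ^ N dvd f" by (metis dvd_triv_left)
qed

text \<open>A nonempty list in \<open>A\<close> has sum at least \<open>v\<close>, so only the empty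
  list contributes below \<open>v\<close>.\<close>

lemma gen_fun_large_parts:
  assumes "[] \<in> A" "\<forall>xs\<in>A. \<forall>p\<in>set xs. v \<le> size_of p"
  shows "fps_X ^ v dvd gen_fun A - 1"
  unfolding fps_X_power_dvd_iff_nth
proof (intro allI impI)
  fix n assume n: "n < v"
  have "{xs \<in> A. parts_sum xs = n} = (if n = 0 then {[]} else {})"
  proof -
    have "xs = []" if "xs \<in> A" "parts_sum xs = n" for xs
    proof (rule ccontr)
      assume "xs \<noteq> []"
      then obtain p where p: "p \<in> set xs" by (cases xs) auto
      then have "v \<le> parts_sum xs" using assms(2) that(1) size_of_le_parts_sum[OF p] by fastforce
      then show False using that n by simp
    qed
    then have "{xs \<in> A. parts_sum xs = n} = {xs \<in> {[]}. parts_sum xs = n}"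
      using assms(1) by blast
    also have "\<dots> = (if n = 0 then {[]} else {})" by auto
    finally show ?thesis .
  qed
  then show "(gen_fun A - 1) $ n = 0" by (simp add: gen_fun_nth)
qed

lemma nonincreasing_snoc:
  "nonincreasing (xs @ [p]) \<longleftrightarrow> nonincreasing xs \<and> (\<forall>r\<in>set xs. size_of p \<le> size_of r)"
  by (auto simp: nonincreasing_def sorted_wrt_append)

section \<open>Overpartitions with bounded windows\<close>

definition gap :: "part \<Rightarrow> nat" where
  "gap p = (if overlined p then 1 else 2)"

text \<open>The subtraction in the difference condition is moved to the other side, so that natural
  numbers suffice.\<close>

definition windows :: "nat \<Rightarrow> part list \<Rightarrow> bool" where
  "windows k xs \<longleftrightarrow> (\<forall>l. l + k - 1 < length xs \<longrightarrow>
     size_of (xs ! (l + k - 1)) + gap (xs ! (l + k - 1)) \<le> size_of (xs ! l))"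

definition overlined_last :: "part list \<Rightarrow> bool" where
  "overlined_last xs \<longleftrightarrow> (\<forall>j<length xs. overlined (xs ! j) \<longrightarrow>
     (\<forall>m. j < m \<and> m < length xs \<longrightarrow> size_of (xs ! m) \<noteq> size_of (xs ! j)))"

definition B_list :: "nat \<Rightarrow> part list \<Rightarrow> bool" where
  "B_list k xs \<longleftrightarrow> nonincreasing xs \<and> overlined_last xs \<and> windows k xs"

text \<open>The strict bound \<open>< i\<close> avoids the truncated \<open>i - 1\<close>. The lists
  counted by \<open>Bset\<close> are the case \<open>v = 1\<close>,
  \<open>i \<ge> 1\<close>.\<close>

definition B_from :: "nat \<Rightarrow> nat \<Rightarrow> nat \<Rightarrow> part list set" where
  "B_from k v i = {xs. B_list k xs \<and> (\<forall>p\<in>set xs. v \<le> size_of p) \<and>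
     length (filter (\<lambda>p. size_of p = v) xs) < i}"

section \<open>Appending a smallest part\<close>

lemma overlined_last_snoc:
  "overlined_last (xs @ [p]) \<longleftrightarrow>
     overlined_last xs \<and> (\<forall>r\<in>set xs. overlined r \<longrightarrow> size_of r \<noteq> size_of p)"
  (is "?L \<longleftrightarrow> ?R")
proof
  assume L: ?L
  show ?R
  proof
    show "overlined_last xs"
      unfolding overlined_last_def
    proof (intro allI impI)
      fix j m assume *: "j < length xs" "overlined (xs ! j)" "j < m \<and> m < length xs"
      then show "size_of (xs ! m) \<noteq> size_of (xs ! j)"
        using L[unfolded overlined_last_def, rule_format, of j m] by (auto simp: nth_append)
    qed
    show "\<forall>r\<in>set xs. overlined r \<longrightarrow> size_of r \<noteq> size_of p"
    proof (intro ballI impI)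
      fix r assume "r \<in> set xs" "overlined r"
      then obtain j where "j < length xs" "xs ! j = r" by (auto simp: in_set_conv_nth)
      then show "size_of r \<noteq> size_of p"
        using L[unfolded overlined_last_def, rule_format, of j "length xs"] \<open>overlined r\<close>
        by (auto simp: nth_append)
    qed
  qed
next
  assume ?R
  then show ?L
    by (auto simp: overlined_last_def nth_append less_Suc_eq)
qed

text \<open>Entries below \<open>s\<close> form a final segment of the list; entry \<open>l\<close>
  lies outside it iff the segment is shorter than the tail starting at \<open>l\<close>. This turns
  window conditions into counts.\<close>

lemma nonincreasing_nth_ge_iff:
  assumes "nonincreasing xs" "l < length xs"
  shows "s \<le> size_of (xs ! l) \<longleftrightarrow> length (filter (\<lambda>r. size_of r < s) xs) < length xs - l"
  using assms
proof (induction xs arbitrary: l)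
  case (Cons p xs)
  have le: "\<forall>r\<in>set xs. size_of r \<le> size_of p" and ni: "nonincreasing xs"
    using Cons.prems by (auto simp: nonincreasing_def)
  show ?case
  proof (cases "size_of p < s")
    case True
    then have "filter (\<lambda>r. size_of r < s) (p # xs) = p # xs"
      using le by (intro filter_True) fastforce
    moreover have "size_of ((p # xs) ! l) < s"
      using True le Cons.prems(2) by (metis nth_mem le_less_trans set_ConsD)
    ultimately show ?thesis by simp
  next
    case False
    have "length (filter (\<lambda>r. size_of r < s) xs) \<le> length xs" by simp
    then show ?thesis using False Cons.IH[OF ni] Cons.prems(2)
      by (cases l) (auto simp: less_Suc_eq_le)
  qed
qed simp

text \<open>The only new window is the one ending in \<open>p\<close>. Its first entry is large
  enough iff fewer than \<open>k\<close> entries lie below \<open>size_of p + gap p\<close>.\<close>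

lemma windows_snoc:
  assumes "nonincreasing (xs @ [p])" "k \<ge> 1"
  shows "windows k (xs @ [p]) \<longleftrightarrow> windows k xs \<and>
    length (filter (\<lambda>r. size_of r < size_of p + gap p) (xs @ [p])) < k" (is "_ \<longleftrightarrow> _ \<and> ?c < k")
proof -
  let ?ys = "xs @ [p]"
  let ?ok = "\<lambda>ys l. size_of (ys ! (l + k - 1)) + gap (ys ! (l + k - 1)) \<le> size_of (ys ! l)"
  have old: "?ok ?ys l \<longleftrightarrow> ?ok xs l" if "l + k - 1 < length xs" for l
    using that assms(2) by (subst (1 2 3) nth_append) auto
  have "windows k ?ys \<longleftrightarrow> windows k xs \<and> (\<forall>l. l + k - 1 = length xs \<longrightarrow> ?ok ?ys l)"
    using old by (auto simp: windows_def less_Suc_eq)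
  also have "(\<forall>l. l + k - 1 = length xs \<longrightarrow> ?ok ?ys l) \<longleftrightarrow> ?c < k"
  proof (cases "k \<le> length ?ys")
    case True
    define l where "l = length ?ys - k"
    have uniq: "l' + k - 1 = length xs \<longleftrightarrow> l' = l" for l'
      using True assms(2) by (auto simp: l_def)
    have l: "l < length ?ys" "length ?ys - l = k" using True assms(2) by (auto simp: l_def)
    have "?ok ?ys l \<longleftrightarrow> size_of p + gap p \<le> size_of (?ys ! l)"
      using uniq[of l] by simp
    then show ?thesis
      using nonincreasing_nth_ge_iff[OF assms(1) l(1), of "size_of p + gap p"] l(2) uniq by simp
  next
    \<comment> \<open>With fewer than \<open>k\<close> entries no window ends in \<open>p\<close>,
      and the count is below \<open>k\<close> for trivial reasons.\<close>
    case False
    have "?c \<le> length ?ys" by (rule length_filter_le)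
    then show ?thesis using False by auto
  qed
  finally show ?thesis .
qed

lemma B_list_snoc:
  assumes "k \<ge> 1"
  shows "B_list k (xs @ [p]) \<longleftrightarrow> B_list k xs \<and>
    (\<forall>r\<in>set xs. size_of p \<le> size_of r \<and> (overlined r \<longrightarrow> size_of r \<noteq> size_of p)) \<and>
    length (filter (\<lambda>r. size_of r < size_of p + gap p) (xs @ [p])) < k"
proof (cases "nonincreasing (xs @ [p])")
  case True
  show ?thesis
    unfolding B_list_def overlined_last_snoc windows_snoc[OF True assms] using True
    by (auto simp: nonincreasing_snoc)
next
  case False
  then show ?thesis by (auto simp: B_list_def nonincreasing_snoc)
qed

lemma B_list_Nil: "k \<ge> 1 \<Longrightarrow> B_list k []"
  by (simp add: B_list_def nonincreasing_def overlined_last_def windows_def)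

section \<open>Splitting off all copies of the smallest value\<close>

lemma filter_size_of_eq_Nil: "\<forall>p\<in>set ys. Suc v \<le> size_of p \<Longrightarrow> filter (\<lambda>r. size_of r = v) ys = []"
  "\<forall>p\<in>set ys. Suc v \<le> size_of p \<Longrightarrow> filter (\<lambda>r. size_of r < Suc v) ys = []"
  by (auto simp: filter_empty_conv)

text \<open>A non-overlined \<open>v\<close> has gap 2, so its window condition counts the entries
  \<open>v\<close> and \<open>v + 1\<close>. The last of the \<open>j\<close> copies gives the
  strongest bound.\<close>

lemma B_list_append_replicate:
  assumes "k \<ge> 1" "\<forall>p\<in>set ys. Suc v \<le> size_of p"
  shows "B_list k (ys @ replicate j (Part v False)) \<longleftrightarrow>
    B_list k ys \<and> (j > 0 \<longrightarrow> length (filter (\<lambda>r. size_of r = Suc v) ys) + j < k)"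
proof (induction j)
  case (Suc j)
  have *: "filter (\<lambda>r. size_of r < Suc (Suc v)) ys = filter (\<lambda>r. size_of r = Suc v) ys"
    using assms(2) by (intro filter_cong) auto
  have "B_list k (ys @ replicate (Suc j) (Part v False)) \<longleftrightarrow>
      B_list k ((ys @ replicate j (Part v False)) @ [Part v False])"
    by (simp add: replicate_append_same)
  also have "\<dots> \<longleftrightarrow> B_list k (ys @ replicate j (Part v False)) \<and>
      length (filter (\<lambda>r. size_of r = Suc v) ys) + Suc j < k"
    unfolding B_list_snoc[OF assms(1)] using assms(2)
    by (auto simp: gap_def * filter_replicate) (metis part.sel(2))+
  finally show ?case using Suc by auto
qed simp

text \<open>An overlined \<open>v\<close> has gap 1, so its window condition counts only the copies
  of \<open>v\<close>, itself included.\<close>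

lemma B_list_append_replicate_overlined:
  assumes "k \<ge> 1" "\<forall>p\<in>set ys. Suc v \<le> size_of p"
  shows "B_list k (ys @ replicate j (Part v False) @ [Part v True]) \<longleftrightarrow>
    B_list k (ys @ replicate j (Part v False)) \<and> Suc j < k"
  using B_list_snoc[OF assms(1), of "ys @ replicate j (Part v False)" "Part v True"] assms(2)
  by (auto simp: gap_def filter_size_of_eq_Nil) (metis part.sel(2))+

lemma B_list_split:
  assumes "k \<ge> 1" "B_list k xs" "\<forall>p\<in>set xs. v \<le> size_of p"
  obtains ys j where "\<forall>p\<in>set ys. Suc v \<le> size_of p" "xs = ys @ replicate j (Part v False)"
  | ys j where "\<forall>p\<in>set ys. Suc v \<le> size_of p" "xs = ys @ replicate j (Part v False) @ [Part v True]"
proof -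
  have "\<exists>ys j. (\<forall>p\<in>set ys. Suc v \<le> size_of p) \<and> (xs = ys @ replicate j (Part v False) \<or>
      xs = ys @ replicate j (Part v False) @ [Part v True])"
    using assms(2,3)
  proof (induction xs rule: rev_induct)
    case (snoc p xs)
    note s = snoc.prems(1)[unfolded B_list_snoc[OF assms(1)]]
    show ?case
    proof (cases "size_of p = v")
      case True
      obtain ys j where ys: "\<forall>p\<in>set ys. Suc v \<le> size_of p"
        and "xs = ys @ replicate j (Part v False) \<or> xs = ys @ replicate j (Part v False) @ [Part v True]"
        using snoc.IH s snoc.prems(2) by auto
      \<comment> \<open>As \<open>p\<close> repeats the value \<open>v\<close>, no earlier
        \<open>v\<close> may be overlined; this rules out the second form.\<close>
      then have xs: "xs = ys @ replicate j (Part v False)" using s True by auto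
      show ?thesis
      proof (cases "overlined p")
        case True
        then show ?thesis using ys xs \<open>size_of p = v\<close> by (cases p) auto
      next
        case False
        then have "xs @ [p] = ys @ replicate (Suc j) (Part v False)"
          using xs \<open>size_of p = v\<close> by (cases p) (auto simp: replicate_append_same)
        then show ?thesis using ys by blast
      qed
    next
      case False
      then have "\<forall>r\<in>set (xs @ [p]). Suc v \<le> size_of r" using s snoc.prems(2) by fastforce
      moreover have "xs @ [p] = (xs @ [p]) @ replicate 0 (Part v False)" by simp
      ultimately show ?thesis by blast
    qed
  qed auto
  then show thesis using that by blast
qed

lemma B_list_count_smallest:
  assumes "k \<ge> 1" "B_list k xs" "\<forall>p\<in>set xs. v \<le> size_of p"
  shows "length (filter (\<lambda>p. size_of p = v) xs) < k"
  using B_list_split[OF assms]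
proof cases
  case (1 ys j)
  then show ?thesis using assms(1,2) B_list_append_replicate[OF assms(1) 1(1), of j]
    by (auto simp: filter_size_of_eq_Nil)
next
  case (2 ys j)
  then show ?thesis using assms(1,2) B_list_append_replicate_overlined[OF assms(1) 2(1), of j]
    by (auto simp: filter_size_of_eq_Nil)
qed

text \<open>Without parts \<open>v\<close> all parts are at least \<open>v + 1\<close>, and fewer
  than \<open>k\<close> copies of \<open>v + 1\<close> are then automatic by
  \<open>B_list_count_smallest\<close>.\<close>

lemma B_from_1:
  assumes "k \<ge> 1"
  shows "B_from k v 1 = B_from k (Suc v) k"
proof -
  have "(\<forall>p\<in>set xs. v \<le> size_of p) \<and> length (filter (\<lambda>p. size_of p = v) xs) < 1 \<longleftrightarrow>
     (\<forall>p\<in>set xs. Suc v \<le> size_of p)" for xs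
    by (auto simp: filter_empty_conv) (metis le_neq_implies_less Suc_le_eq)
  then show ?thesis using B_list_count_smallest[OF assms] by (auto simp: B_from_def)
qed

text \<open>The additional lists contain exactly \<open>i\<close> copies of \<open>v\<close>. Either
  all are plain, which leaves fewer than \<open>k - i\<close> copies of \<open>v + 1\<close>, or the
  last is overlined and only \<open>i - 1\<close> plain copies count, which raises the bound by
  one.\<close>

lemma B_from_Suc:
  assumes "1 \<le> i" "i < k"
  shows "B_from k v (Suc i) = B_from k v i \<union>
    ((\<lambda>ys. ys @ replicate i (Part v False)) ` B_from k (Suc v) (k - i) \<union>
     (\<lambda>ys. ys @ (replicate (i - 1) (Part v False) @ [Part v True])) ` B_from k (Suc v) (Suc (k - i)))"
    (is "?L = _ \<union> (?F ` _ \<union> ?T ` _)")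
proof (intro equalityI subsetI)
  have k: "k \<ge> 1" using assms by simp
  fix xs assume xs: "xs \<in> ?L"
  then have *: "B_list k xs" "\<forall>p\<in>set xs. v \<le> size_of p" by (auto simp: B_from_def)
  show "xs \<in> B_from k v i \<union> (?F ` B_from k (Suc v) (k - i) \<union> ?T ` B_from k (Suc v) (Suc (k - i)))"
  proof (cases "xs \<in> B_from k v i")
    case False
    then have len: "length (filter (\<lambda>p. size_of p = v) xs) = i" using xs by (auto simp: B_from_def)
    show ?thesis using B_list_split[OF k *]
    proof cases
      case (1 ys j)
      then have "j = i" using len by (simp add: filter_size_of_eq_Nil)
      then have "ys \<in> B_from k (Suc v) (k - i)"
        using 1 *(1) B_list_append_replicate[OF k 1(1), of j] assms by (auto simp: B_from_def)
      then show ?thesis using 1 \<open>j = i\<close> by blast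
    next
      case (2 ys j)
      then have j: "i = Suc j" using len by (simp add: filter_size_of_eq_Nil)
      have B: "B_list k (ys @ replicate j (Part v False))"
        using *(1) 2 B_list_append_replicate_overlined[OF k 2(1)] by simp
      then have "B_list k ys" using B_list_append_replicate[OF k 2(1)] by simp
      \<comment> \<open>For \<open>j = 0\<close> no plain \<open>v\<close> restricts
        \<open>ys\<close>; the bound is then \<open>k\<close> and comes from
        \<open>B_list_count_smallest\<close>.\<close>
      then have "ys \<in> B_from k (Suc v) (Suc (k - i))"
        using 2 B B_list_append_replicate[OF k 2(1), of j] assms j B_list_count_smallest[OF k _ 2(1)]
        by (cases "j = 0") (auto simp: B_from_def)
      then show ?thesis using 2 j by auto
    qed
  qed simp
next
  have k: "k \<ge> 1" using assms by simp
  fix xs assume "xs \<in> B_from k v i \<union> (?F ` B_from k (Suc v) (k - i) \<union> ?T ` B_from k (Suc v) (Suc (k - i)))"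
  then consider "xs \<in> B_from k v i"
    | ys where "ys \<in> B_from k (Suc v) (k - i)" "xs = ?F ys"
    | ys where "ys \<in> B_from k (Suc v) (Suc (k - i))" "xs = ?T ys" by blast
  then show "xs \<in> ?L"
  proof cases
    case 1
    then show ?thesis by (auto simp: B_from_def)
  next
    case (2 ys)
    then have ys: "\<forall>p\<in>set ys. Suc v \<le> size_of p" by (auto simp: B_from_def)
    show ?thesis using 2 B_list_append_replicate[OF k ys, of i] assms
      by (auto simp: B_from_def filter_size_of_eq_Nil)
  next
    case (3 ys)
    then have ys: "\<forall>p\<in>set ys. Suc v \<le> size_of p" by (auto simp: B_from_def)
    show ?thesis using 3 B_list_append_replicate[OF k ys, of "i - 1"]
        B_list_append_replicate_overlined[OF k ys, of "i - 1"] assms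
      by (auto simp: B_from_def filter_size_of_eq_Nil)
  qed
qed

section \<open>From \<open>Bset\<close> to generating functions of \<open>B_from\<close>\<close>

lemma overpartition_iff:
  "overpartition n xs \<longleftrightarrow> nonincreasing xs \<and> parts_sum xs = n \<and> (\<forall>p\<in>set xs. 0 < size_of p) \<and>
    overlined_last xs"
  by (simp add: overpartition_def overlined_last_def)

lemma Bset_eq_B_from:
  assumes "i \<ge> 1"
  shows "Bset k i n = {xs \<in> B_from k 1 i. parts_sum xs = n}"
proof -
  have "windows k xs \<longleftrightarrow> (\<forall>l. l + k - 1 < length xs \<longrightarrow>
        int (size_of (xs ! l)) - int (size_of (xs ! (l + k - 1)))
          \<ge> (if overlined (xs ! (l + k - 1)) then 1 else 2))" for xs
    unfolding windows_def gap_def by (intro all_cong1 imp_cong refl) auto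
  then show ?thesis
    using assms by (auto simp: Bset_def B_from_def B_list_def overpartition_iff Suc_le_eq)
qed

lemma finitely_many_B_from:
  assumes "v \<ge> 1"
  shows "finitely_many_per_sum (B_from k v i)"
  unfolding finitely_many_per_sum_def
proof
  fix n
  have "{xs \<in> B_from k v i. parts_sum xs = n} \<subseteq> {xs. overpartition n xs}"
    using assms by (force simp: B_from_def B_list_def overpartition_iff Suc_le_eq)
  then show "finite {xs \<in> B_from k v i. parts_sum xs = n}"
    using finite_overpartitions finite_subset by blast
qed

text \<open>Both tails in \<open>B_from_Suc\<close> have \<open>i\<close> parts equal to
  \<open>v\<close>, hence the common factor.\<close>

lemma gen_fun_B_from_Suc:
  assumes "1 \<le> i" "i < k" "v \<ge> 1"
  shows "gen_fun (B_from k v (Suc i)) = gen_fun (B_from k v i) +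
    fps_X ^ (i * v) * (gen_fun (B_from k (Suc v) (k - i)) + gen_fun (B_from k (Suc v) (Suc (k - i))))"
proof -
  let ?F = "(\<lambda>ys. ys @ replicate i (Part v False)) ` B_from k (Suc v) (k - i)"
  let ?T = "(\<lambda>ys. ys @ (replicate (i - 1) (Part v False) @ [Part v True])) ` B_from k (Suc v) (Suc (k - i))"
  have eq: "B_from k v (Suc i) = B_from k v i \<union> (?F \<union> ?T)" by (rule B_from_Suc[OF assms(1,2)])
  have fin: "finitely_many_per_sum (B_from k v (Suc i))" by (rule finitely_many_B_from[OF assms(3)])
  have "xs \<notin> B_from k v i" if "xs \<in> ?F \<union> ?T" for xs
    using that assms(1) by (auto simp: B_from_def)
  then have d1: "B_from k v i \<inter> (?F \<union> ?T) = {}" by blast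
  \<comment> \<open>The overlining of the last entry separates the two families;
    \<open>i \<ge> 1\<close> makes the plain tail nonempty.\<close>
  have "last xs = Part v False" if "xs \<in> ?F" for xs using that assms(1) by auto
  moreover have "last xs = Part v True" if "xs \<in> ?T" for xs using that by auto
  ultimately have d2: "?F \<inter> ?T = {}" by fastforce
  have "gen_fun (B_from k v (Suc i)) = gen_fun (B_from k v i) + (gen_fun ?F + gen_fun ?T)"
    by (rule gen_fun_union3[OF eq fin d1 d2])
  moreover have "(i - 1) * v + v = i * v" using assms(1) by (cases i) auto
  ultimately show ?thesis by (simp add: gen_fun_append algebra_simps)
qed

section \<open>Superpartitions\<close>

definition overlined_first :: "part list \<Rightarrow> bool" where
  "overlined_first xs \<longleftrightarrow> (\<forall>j<length xs. overlined (xs ! j) \<longrightarrow>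
     (\<forall>m<j. size_of (xs ! m) \<noteq> size_of (xs ! j)))"

text \<open>\<open>A\<close> restricts only the non-overlined sizes. For \<open>v = 0\<close> and
  \<open>0 \<notin> A\<close> the overlined 0 is allowed, the plain 0 is not.\<close>

definition S_from :: "nat set \<Rightarrow> nat \<Rightarrow> part list set" where
  "S_from A v = {xs. nonincreasing xs \<and> overlined_first xs \<and> (\<forall>p\<in>set xs. v \<le> size_of p) \<and>
     (\<forall>p\<in>set xs. \<not> overlined p \<longrightarrow> size_of p \<in> A)}"

lemma overlined_first_snoc:
  "overlined_first (xs @ [p]) \<longleftrightarrow>
     overlined_first xs \<and> (overlined p \<longrightarrow> (\<forall>r\<in>set xs. size_of r \<noteq> size_of p))"
  by (auto simp: overlined_first_def nth_append less_Suc_eq all_set_conv_all_nth)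

lemma snoc_in_S_from:
  "xs @ [p] \<in> S_from A v \<longleftrightarrow> xs \<in> S_from A v \<and> v \<le> size_of p \<and>
     (\<forall>r\<in>set xs. size_of p \<le> size_of r \<and> (overlined p \<longrightarrow> size_of r \<noteq> size_of p)) \<and>
     (\<not> overlined p \<longrightarrow> size_of p \<in> A)"
  by (auto simp: S_from_def overlined_first_snoc nonincreasing_snoc)

lemma S_from_Suc:
  "S_from A (Suc v) = {xs \<in> S_from A v. \<forall>p\<in>set xs. size_of p \<noteq> v}"
proof -
  have "Suc v \<le> size_of p \<longleftrightarrow> v \<le> size_of p \<and> size_of p \<noteq> v" for p by auto
  then show ?thesis unfolding S_from_def by blast
qed

text \<open>If \<open>v\<close> occurs, it is the last entry. When that entry is overlined it is the
  only \<open>v\<close>, since only first occurrences carry a line; when it is plain, the rest may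
  still contain \<open>v\<close>.\<close>

lemma S_from_split:
  "S_from A v = S_from A (Suc v) \<union> ((\<lambda>ys. ys @ [Part v True]) ` S_from A (Suc v) \<union>
     (if v \<in> A then (\<lambda>ys. ys @ [Part v False]) ` S_from A v else {}))" (is "_ = ?R")
proof (intro equalityI subsetI)
  fix xs assume xs: "xs \<in> S_from A v"
  show "xs \<in> ?R"
  proof (cases xs rule: rev_cases)
    case Nil
    then show ?thesis using xs by (auto simp: S_from_Suc)
  next
    case (snoc ys p)
    show ?thesis
    proof (cases "size_of p = v")
      case True
      then show ?thesis using xs[unfolded snoc snoc_in_S_from] unfolding snoc
        by (cases p; cases "overlined p") (auto simp: S_from_Suc)
    next
      case False
      then show ?thesis using xs xs[unfolded snoc snoc_in_S_from] unfolding snoc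
        by (fastforce simp: S_from_Suc)
    qed
  qed
next
  fix xs assume "xs \<in> ?R"
  moreover have "v \<le> size_of r" if "ys \<in> S_from A v" "r \<in> set ys" for ys r
    using that by (auto simp: S_from_def)
  ultimately show "xs \<in> S_from A v"
    by (auto simp: S_from_Suc snoc_in_S_from split: if_splits)
qed

lemma superpartition_iff:
  "superpartition n xs \<longleftrightarrow> nonincreasing xs \<and> parts_sum xs = n \<and>
     (\<forall>p\<in>set xs. \<not> overlined p \<longrightarrow> size_of p > 0) \<and> overlined_first xs"
  by (simp add: superpartition_def overlined_first_def)

lemma finitely_many_S_from: "0 \<notin> A \<Longrightarrow> finitely_many_per_sum (S_from A v)"
  unfolding finitely_many_per_sum_def
  by (intro allI finite_subset[OF _ finite_superpartitions])
     (auto simp: S_from_def superpartition_iff intro!: gr0I)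

text \<open>The family ending in a plain \<open>v\<close> reproduces \<open>S_from A v\<close>;
  moving it to the left gives the geometric factor without a division.\<close>

lemma gen_fun_S_from:
  assumes "0 \<notin> A"
  shows "(if v \<in> A then 1 - fps_X ^ v else 1) * gen_fun (S_from A v) =
    (1 + fps_X ^ v) * gen_fun (S_from A (Suc v))"
proof -
  let ?T = "(\<lambda>ys. ys @ [Part v True]) ` S_from A (Suc v)"
  let ?F = "if v \<in> A then (\<lambda>ys. ys @ [Part v False]) ` S_from A v else {}"
  have eq: "S_from A v = S_from A (Suc v) \<union> (?T \<union> ?F)" by (rule S_from_split)
  have fin: "finitely_many_per_sum (S_from A v)" by (rule finitely_many_S_from[OF assms])
  have d1: "S_from A (Suc v) \<inter> (?T \<union> ?F) = {}" by (auto simp: S_from_Suc)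
  have d2: "?T \<inter> ?F = {}" by auto
  have "gen_fun (S_from A v) = gen_fun (S_from A (Suc v)) + (gen_fun ?T + gen_fun ?F)"
    by (rule gen_fun_union3[OF eq fin d1 d2])
  moreover have "gen_fun ?F = (if v \<in> A then fps_X ^ v * gen_fun (S_from A v) else 0)"
    by (simp add: gen_fun_append)
  ultimately show ?thesis by (auto simp: gen_fun_append algebra_simps)
qed

lemma gen_fun_S_from_prod:
  assumes "0 \<notin> A"
  shows "gen_fun (S_from A 1) * (\<Prod>j\<in>{1..M} \<inter> A. 1 - fps_X ^ j) =
    (\<Prod>j=1..M. 1 + fps_X ^ j) * gen_fun (S_from A (Suc M))"
proof (induction M)
  case (Suc M)
  have "(\<Prod>j\<in>{1..Suc M} \<inter> A. 1 - fps_X ^ j :: real fps) =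
      (if Suc M \<in> A then 1 - fps_X ^ Suc M else 1) * (\<Prod>j\<in>{1..M} \<inter> A. 1 - fps_X ^ j)"
    by (auto simp: atLeastAtMostSuc_conv Int_insert_left)
  then have "gen_fun (S_from A 1) * (\<Prod>j\<in>{1..Suc M} \<inter> A. 1 - fps_X ^ j) =
      (if Suc M \<in> A then 1 - fps_X ^ Suc M else 1) *
        (gen_fun (S_from A 1) * (\<Prod>j\<in>{1..M} \<inter> A. 1 - fps_X ^ j))"
    by (simp only: ac_simps)
  also have "\<dots> = (\<Prod>j=1..M. 1 + fps_X ^ j) *
      ((if Suc M \<in> A then 1 - fps_X ^ Suc M else 1) * gen_fun (S_from A (Suc M)))"
    unfolding Suc.IH by (simp only: ac_simps)
  also have "\<dots> = (\<Prod>j=1..Suc M. 1 + fps_X ^ j) * gen_fun (S_from A (Suc (Suc M)))"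
    unfolding gen_fun_S_from[OF assms] by (simp add: ac_simps)
  finally show ?case .
qed simp

section \<open>The recurrence for the overpartition generating functions\<close>

text \<open>The values at \<open>i = 0\<close> and \<open>i = k\<close> are the ones that make the recurrence below hold for all
  \<open>p < k\<close>.\<close>

definition B_pair :: "nat \<Rightarrow> nat \<Rightarrow> nat \<Rightarrow> real fps" where
  "B_pair k m i = (if i = 0 then 0
     else if i < k then gen_fun (B_from k (Suc m) i) + gen_fun (B_from k (Suc m) (Suc i))
     else 2 * gen_fun (B_from k (Suc m) k))"

text \<open>The difference of neighbouring pairs is the sum of the steps of
  \<open>gen_fun_B_from_Suc\<close> for \<open>i = p\<close> and \<open>i = p + 1\<close>.\<close>

lemma B_pair_recurrence:
  assumes "k \<ge> 2" "p < k"
  shows "B_pair k m (Suc p) = B_pair k m p + fps_X ^ (Suc m * p) * B_pair k (Suc m) (k - p) +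
    fps_X ^ (Suc m * Suc p) * B_pair k (Suc m) (k - Suc p)"
proof -
  let ?g = "\<lambda>i. gen_fun (B_from k (Suc m) i)"
  let ?G = "\<lambda>i. gen_fun (B_from k (Suc (Suc m)) i)"
  have step: "?g (Suc i) = ?g i + fps_X ^ (Suc m * i) * (?G (k - i) + ?G (Suc (k - i)))"
    if "1 \<le> i" "i < k" for i
    using gen_fun_B_from_Suc[OF that, of "Suc m"] by (simp add: mult.commute)
  have one: "?g (Suc 0) = ?G k"
    using B_from_1[of k "Suc m"] assms(1) by simp
  consider "p = 0" | "1 \<le> p" "Suc p < k" | "1 \<le> p" "Suc p = k" using assms(2) by linarith
  then show ?thesis
  proof cases
    \<comment> \<open>Here \<open>B_from_1\<close> replaces the missing step at
      \<open>i = 0\<close>; it yields \<open>2 * ?G k\<close>, the boundary value of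
      \<open>B_pair\<close> at \<open>k\<close>.\<close>
    case 1
    have "Suc (k - 1) = k" using assms(1) by simp
    then show ?thesis using 1 assms(1) step[of 1] one
      by (simp add: B_pair_def algebra_simps)
  next
    case 2
    have "Suc (k - Suc p) = k - p" using 2 by simp
    then show ?thesis using 2 step[of p] step[of "Suc p"]
      by (simp add: B_pair_def algebra_simps)
  next
    \<comment> \<open>Only the step for \<open>i = p\<close> remains, and the last term vanishes
      because \<open>B_pair\<close> is 0 at 0.\<close>
    case 3
    have "k - p = 1" using 3 by simp
    then show ?thesis using 3 step[of p] assms(1)
      by (simp add: B_pair_def algebra_simps)
  qed
qed

lemma B_pair_low_order:
  assumes "k \<ge> 2" "1 \<le> i" "i \<le> k"
  shows "fps_X ^ Suc m dvd B_pair k m i - 2"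
proof -
  have *: "fps_X ^ Suc m dvd gen_fun (B_from k (Suc m) j) - 1" if "1 \<le> j" for j
    using assms(1) that by (intro gen_fun_large_parts) (auto simp: B_from_def B_list_Nil)
  show ?thesis
  proof (cases "i < k")
    case True
    then have "B_pair k m i - 2 =
        (gen_fun (B_from k (Suc m) i) - 1) + (gen_fun (B_from k (Suc m) (Suc i)) - 1)"
      using assms by (simp add: B_pair_def)
    then show ?thesis using *[of i] *[of "Suc i"] assms(2) by (simp only: dvd_add le_SucI)
  next
    case False
    then have "B_pair k m i - 2 = 2 * (gen_fun (B_from k (Suc m) k) - 1)"
      using assms by (simp add: B_pair_def algebra_simps)
    then show ?thesis using *[of k] assms(1) by (metis dvd_mult le_trans one_le_numeral)
  qed
qed

text \<open>Uniqueness modulo \<open>z\<close>, to be applied to the difference \<open>D\<close> of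
  two solutions: level \<open>m + 1\<close> determines level \<open>m\<close> by induction on
  \<open>i\<close> from \<open>D m 0\<close>, so descending from level \<open>M\<close> reaches
  every level.\<close>

lemma recurrence_dvd:
  fixes D :: "nat \<Rightarrow> nat \<Rightarrow> 'a :: comm_ring_1"
  assumes zero: "\<And>m. z dvd D m 0"
    and step: "\<And>m p. p < k \<Longrightarrow>
      z dvd D m (Suc p) - (D m p + c m p * D (Suc m) (k - p) + d m p * D (Suc m) (k - Suc p))"
    and base: "\<And>i. i \<le> k \<Longrightarrow> z dvd D M i"
    and "m \<le> M" "i \<le> k"
  shows "z dvd D m i"
  using \<open>m \<le> M\<close> \<open>i \<le> k\<close>
proof (induction m arbitrary: i rule: inc_induct)
  case base
  then show ?case by (rule assms(3))
next
  case (step m)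
  note next_level = step.IH
  show ?case using step.prems
  proof (induction i)
    case 0
    show ?case by (rule zero)
  next
    case (Suc p)
    have "z dvd D m p + c m p * D (Suc m) (k - p) + d m p * D (Suc m) (k - Suc p)"
      using Suc next_level by (intro dvd_add dvd_mult) auto
    with assms(2)[of p m] Suc.prems show ?case
      by (metis Suc_le_eq diff_add_cancel dvd_add)
  qed
qed

section \<open>An explicit solution of the recurrence\<close>

lemma fps_X_power_dvd_unit_cancel:
  fixes f u :: "real fps"
  assumes "u $ 0 \<noteq> 0" "fps_X ^ N dvd u * f"
  shows "fps_X ^ N dvd f"
proof -
  have "f = inverse u * (u * f)"
    using inverse_mult_eq_1[OF assms(1)] by (simp add: mult.assoc[symmetric])
  then show ?thesis using assms(2) by (metis dvd_mult)
qed

lemma prod_one_minus_X_nth_0: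
  assumes "\<And>j. j \<in> S \<Longrightarrow> 0 < e j"
  shows "(\<Prod>j\<in>S. 1 - fps_X ^ e j :: real fps) $ 0 = 1"
  using assms
proof (induction S rule: infinite_finite_induct)
  case (insert x S)
  then show ?case by (simp add: fps_mult_nth_0 fps_X_power_nth)
qed auto

text \<open>In q-Pochhammer notation this is (q^(n+1); q)_m / (-q^(n+1); q)_m.\<close>

definition ratio :: "nat \<Rightarrow> nat \<Rightarrow> real fps" where
  "ratio n m = (\<Prod>j\<in>{n<..n + m}. (1 - fps_X ^ j) * inverse (1 + fps_X ^ j))"

lemma one_plus_X_inverse:
  "j \<ge> 1 \<Longrightarrow> (1 + fps_X ^ j) * (f * inverse (1 + fps_X ^ j)) = (f :: real fps)"
proof -
  assume "j \<ge> 1"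
  then have "(1 + fps_X ^ j :: real fps) $ 0 \<noteq> 0" by (simp add: fps_X_power_nth)
  from inverse_mult_eq_1[OF this] show ?thesis by (simp add: algebra_simps)
qed

lemma ratio_0 [simp]: "ratio n 0 = 1"
  by (simp add: ratio_def)

lemma ratio_Suc_top:
  "(1 + fps_X ^ Suc (n + m)) * ratio n (Suc m) = (1 - fps_X ^ Suc (n + m)) * ratio n m"
proof -
  have "{n<..n + Suc m} = insert (Suc (n + m)) {n<..n + m}" by auto
  then have "ratio n (Suc m) =
      (1 - fps_X ^ Suc (n + m)) * inverse (1 + fps_X ^ Suc (n + m)) * ratio n m"
    by (simp add: ratio_def)
  then show ?thesis
    using one_plus_X_inverse[of "Suc (n + m)" "(1 - fps_X ^ Suc (n + m)) * ratio n m"]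
    by (simp only: ac_simps)
qed

lemma ratio_Suc_bottom:
  "(1 + fps_X ^ Suc n) * ratio n (Suc m) = (1 - fps_X ^ Suc n) * ratio (Suc n) m"
proof -
  have "{n<..n + Suc m} = insert (Suc n) {Suc n<..Suc n + m}" by auto
  then have "ratio n (Suc m) =
      (1 - fps_X ^ Suc n) * inverse (1 + fps_X ^ Suc n) * ratio (Suc n) m"
    by (simp add: ratio_def)
  then show ?thesis
    using one_plus_X_inverse[of "Suc n" "(1 - fps_X ^ Suc n) * ratio (Suc n) m"]
    by (simp only: ac_simps)
qed

text \<open>Reconciles two normalisations: \<open>B_pair\<close> is close to 2 at level
  \<open>M\<close>, while \<open>theta\<close> is close to \<open>ratio 0 M\<close>.\<close>

lemma prod_mult_ratio:
  "(\<Prod>j=1..M. 1 + fps_X ^ j) * ratio 0 M = (\<Prod>j=1..M. 1 - fps_X ^ j)"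
proof -
  have "{0<..0 + M} = {1..M}" by auto
  then show ?thesis
    unfolding ratio_def by (simp add: prod.distrib[symmetric] one_plus_X_inverse)
qed

text \<open>The terms of Andrews' series \<open>H\<^sub>k\<^sub>,\<^sub>i(a; x; q)\<close> at \<open>a = -1/q\<close>, \<open>x = q\<^bsup>m+1\<^esup>\<close>, up to the constant
  factor \<open>\<Prod>(1 + q\<^sup>j)/(1 - q\<^sup>j)\<close>; the exponents are written so that truncated subtraction is harmless
  for \<open>i \<le> k\<close>.\<close>

definition theta_term :: "nat \<Rightarrow> nat \<Rightarrow> nat \<Rightarrow> nat \<Rightarrow> real fps" where
  "theta_term k m i n = (-1) ^ n * (fps_X ^ (k * n * n + k * m * n + (k - i) * n) -
     fps_X ^ (k * n * n + k * m * n + k * n + i * n + i * m + i)) * ratio n m"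

definition theta :: "nat \<Rightarrow> nat \<Rightarrow> nat \<Rightarrow> nat \<Rightarrow> real fps" where
  "theta k L m i = (\<Sum>n\<le>L. theta_term k m i n)"

text \<open>For \<open>i = 0\<close> the two exponents in each term coincide.\<close>

lemma theta_0 [simp]: "theta k L m 0 = 0"
  by (simp add: theta_def theta_term_def)

text \<open>A single term satisfies the recurrence up to the telescoping difference of
  \<open>a\<close>.\<close>

lemma theta_term_recurrence:
  fixes k m p n :: nat
  assumes "p < k"
  defines "a \<equiv> \<lambda>n. (-1) ^ n * fps_X ^ (k * n * n + k * m * n + (k - Suc p) * n) *
    (1 - fps_X ^ n) * ratio n m"
  shows "theta_term k m (Suc p) n - (theta_term k m p n +
      fps_X ^ (Suc m * p) * theta_term k (Suc m) (k - p) n +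
      fps_X ^ (Suc m * Suc p) * theta_term k (Suc m) (k - Suc p) n) = a n - a (Suc n)"
proof -
  \<comment> \<open>With \<open>d = k - Suc p\<close> all truncated differences in the exponents
    become plain sums.\<close>
  obtain d where k: "k = p + 1 + d" 
    using assms(1) less_imp_Suc_add by fastforce
  define s where "s = (-1 :: real fps) ^ n"
  define b where "b = (fps_X :: real fps) ^ (k * n * n + k * m * n + k * n + p * n + p * m + p)"
  define c where "c = (fps_X :: real fps) ^ (k * Suc n * Suc n + k * m * Suc n + d * Suc n)"
  define e where "e = (fps_X :: real fps) ^ (k * n * n + k * m * n + d * n)"
  define x where "x = (fps_X :: real fps) ^ Suc n"
  define y where "y = (fps_X :: real fps) ^ Suc (n + m)"
  define w where "w = (fps_X :: real fps) ^ n"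
  define R where "R = ratio n (Suc m)"
  have t1: "theta_term k m (Suc p) n = s * (e - b * y) * ratio n m"
    unfolding theta_term_def s_def e_def b_def y_def
    by (simp add: k power_add[symmetric] algebra_simps)
  have t2: "theta_term k m p n = s * (e * w - b) * ratio n m"
    unfolding theta_term_def s_def e_def b_def w_def
    by (simp add: k power_add[symmetric] algebra_simps)
  have t3: "fps_X ^ (Suc m * p) * theta_term k (Suc m) (k - p) n = s * (b - c * x) * R"
  proof -
    have "fps_X ^ (Suc m * p) * (fps_X ^ (k * n * n + k * Suc m * n + (k - (k - p)) * n) -
        fps_X ^ (k * n * n + k * Suc m * n + k * n + (k - p) * n + (k - p) * Suc m + (k - p))) = b - c * x"
      unfolding b_def c_def x_def right_diff_distrib
      by (simp add: k power_add[symmetric] algebra_simps)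
    then show ?thesis unfolding theta_term_def s_def R_def by (simp add: ac_simps)
  qed
  have t4: "fps_X ^ (Suc m * Suc p) * theta_term k (Suc m) (k - Suc p) n = s * (b * y - c) * R"
  proof -
    have "fps_X ^ (Suc m * Suc p) * (fps_X ^ (k * n * n + k * Suc m * n + (k - (k - Suc p)) * n) -
        fps_X ^ (k * n * n + k * Suc m * n + k * n + (k - Suc p) * n + (k - Suc p) * Suc m + (k - Suc p)))
        = b * y - c"
      unfolding b_def c_def y_def right_diff_distrib
      by (simp add: k power_add[symmetric] algebra_simps)
    then show ?thesis unfolding theta_term_def s_def R_def by (simp add: ac_simps)
  qed
  have an: "a n = s * e * (1 - w) * ratio n m"
    by (simp add: a_def s_def e_def w_def k)
  have "(1 - fps_X ^ Suc n) * ratio (Suc n) m = (1 + x) * R"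
    unfolding x_def R_def by (rule ratio_Suc_bottom[symmetric])
  then have as: "a (Suc n) = - (s * c * ((1 + x) * R))"
    by (simp add: a_def s_def c_def k mult.assoc)
  have top: "(1 - y) * ratio n m = (1 + y) * R"
    unfolding y_def R_def by (rule ratio_Suc_top[symmetric])
  \<comment> \<open>The terms are collected by \<open>e\<close>, \<open>b\<close> and
    \<open>c\<close>: the \<open>e\<close> part is \<open>a n\<close>, the \<open>b\<close> part
    cancels by \<open>top\<close>, and the \<open>c\<close> part is
    \<open>- a (Suc n)\<close>.\<close>
  have "theta_term k m (Suc p) n - (theta_term k m p n +
      fps_X ^ (Suc m * p) * theta_term k (Suc m) (k - p) n +
      fps_X ^ (Suc m * Suc p) * theta_term k (Suc m) (k - Suc p) n)
    = s * e * (1 - w) * ratio n m + s * b * ((1 - y) * ratio n m) - s * b * ((1 + y) * R)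
      + s * c * ((1 + x) * R)"
    unfolding t1 t2 t3 t4 by (simp add: algebra_simps)
  then show ?thesis unfolding top an as by simp
qed

lemma theta_recurrence:
  assumes "p < k"
  shows "fps_X ^ L dvd theta k L m (Suc p) - (theta k L m p +
      fps_X ^ (Suc m * p) * theta k L (Suc m) (k - p) +
      fps_X ^ (Suc m * Suc p) * theta k L (Suc m) (k - Suc p))"
proof -
  define a :: "nat \<Rightarrow> real fps" where "a = (\<lambda>n. (-1) ^ n *
    fps_X ^ (k * n * n + k * m * n + (k - Suc p) * n) * (1 - fps_X ^ n) * ratio n m)"
  have "theta k L m (Suc p) - (theta k L m p +
      fps_X ^ (Suc m * p) * theta k L (Suc m) (k - p) +
      fps_X ^ (Suc m * Suc p) * theta k L (Suc m) (k - Suc p)) = (\<Sum>n\<le>L. a n - a (Suc n))"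
    unfolding theta_def a_def theta_term_recurrence[OF assms, symmetric]
    by (simp only: sum_distrib_left sum.distrib sum_subtractf)
  \<comment> \<open>\<open>a 0\<close> vanishes through its factor
    \<open>1 - fps_X ^ 0\<close>.\<close>
  also have "\<dots> = - a (Suc L)"
    unfolding sum_telescope by (simp add: a_def)
  finally have eq: "theta k L m (Suc p) - (theta k L m p +
      fps_X ^ (Suc m * p) * theta k L (Suc m) (k - p) +
      fps_X ^ (Suc m * Suc p) * theta k L (Suc m) (k - Suc p)) = - a (Suc L)" .
  have "1 * 1 * L \<le> k * Suc L * Suc L" using assms by (intro mult_mono) auto
  then have "L \<le> k * Suc L * Suc L + k * m * Suc L + (k - Suc p) * Suc L" by linarith
  then have "fps_X ^ L dvd a (Suc L)"
    unfolding a_def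
    by (rule dvd_mult2[OF dvd_mult2[OF dvd_mult[OF le_imp_power_dvd]]])
  then show ?thesis unfolding eq by simp
qed

text \<open>The term \<open>n = 0\<close> is \<open>ratio 0 m\<close> up to order
  \<open>i * m + i\<close>, and each later term has order at least \<open>k * m * n\<close>.\<close>

lemma theta_low_order:
  assumes "1 \<le> i" "i \<le> k"
  shows "fps_X ^ m dvd theta k L m i - ratio 0 m"
proof -
  have "theta k L m i = theta_term k m i 0 + (\<Sum>n\<in>{1..L}. theta_term k m i n)"
    unfolding theta_def by (simp add: atMost_atLeast0 sum.atLeast_Suc_atMost)
  moreover have "theta_term k m i 0 = ratio 0 m - fps_X ^ (i * m + i) * ratio 0 m"
    by (simp add: theta_term_def algebra_simps)
  ultimately have eq: "theta k L m i - ratio 0 m =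
      (\<Sum>n\<in>{1..L}. theta_term k m i n) - fps_X ^ (i * m + i) * ratio 0 m"
    by simp
  have "fps_X ^ m dvd theta_term k m i n" if "n \<in> {1..L}" for n
  proof -
    have "1 * m * 1 \<le> k * m * n" using that assms by (intro mult_mono) auto
    then have "m \<le> k * m * n" by simp
    then show ?thesis unfolding theta_term_def
      by (intro dvd_mult2[OF dvd_mult] dvd_diff le_imp_power_dvd) linarith+
  qed
  moreover have "m \<le> i * m + i" using assms(1) by (simp add: trans_le_add1)
  ultimately show ?thesis
    unfolding eq by (intro dvd_diff dvd_sum dvd_mult2 le_imp_power_dvd) auto
qed

text \<open>Both sides satisfy the same recurrence modulo q^N and agree at level \<open>M\<close>,
  so \<open>recurrence_dvd\<close> applies to their difference \<open>D\<close>. The finite products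
  clear the denominators.\<close>

lemma B_pair_eq_theta:
  assumes "k \<ge> 2" "i \<le> k" "N \<le> M"
  shows "fps_X ^ N dvd (\<Prod>j=1..M. 1 - fps_X ^ j) * B_pair k 0 i -
    2 * (\<Prod>j=1..M. 1 + fps_X ^ j) * theta k N 0 i"
proof -
  let ?U = "\<Prod>j=1..M. 1 - fps_X ^ j :: real fps" and ?P = "\<Prod>j=1..M. 1 + fps_X ^ j :: real fps"
  define D where "D = (\<lambda>m i. ?U * B_pair k m i - 2 * ?P * theta k N m i)"
  have "fps_X ^ N dvd D 0 i"
  proof (rule recurrence_dvd[where D = D and z = "fps_X ^ N" and M = M and k = k
        and c = "\<lambda>m p. fps_X ^ (Suc m * p)" and d = "\<lambda>m p. fps_X ^ (Suc m * Suc p)"])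
    show "fps_X ^ N dvd D m 0" for m by (simp add: D_def B_pair_def)
  next
    fix m p assume p: "p < k"
    let ?t = "theta k N m (Suc p) - (theta k N m p +
      fps_X ^ (Suc m * p) * theta k N (Suc m) (k - p) +
      fps_X ^ (Suc m * Suc p) * theta k N (Suc m) (k - Suc p))"
    have "D m (Suc p) - (D m p + fps_X ^ (Suc m * p) * D (Suc m) (k - p) +
        fps_X ^ (Suc m * Suc p) * D (Suc m) (k - Suc p)) = - (2 * ?P) * ?t"
      unfolding D_def B_pair_recurrence[OF assms(1) p] by algebra
    then show "fps_X ^ N dvd D m (Suc p) - (D m p + fps_X ^ (Suc m * p) * D (Suc m) (k - p) +
        fps_X ^ (Suc m * Suc p) * D (Suc m) (k - Suc p))"
      using theta_recurrence[OF p] by (metis dvd_mult)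
  next
    fix i assume "i \<le> k"
    show "fps_X ^ N dvd D M i"
    proof (cases "i = 0")
      case False
      \<comment> \<open>The limits may be subtracted because \<open>?U * 2\<close> equals
        \<open>2 * ?P * ratio 0 M\<close> by \<open>prod_mult_ratio\<close>.\<close>
      have eq: "D M i = ?U * (B_pair k M i - 2) - 2 * ?P * (theta k N M i - ratio 0 M)"
      proof -
        have "U * b - 2 * P * t = U * (b - 2) - 2 * P * (t - r)" if "P * r = U"
          for U P b t r :: "real fps"
          unfolding that[symmetric] by (simp add: algebra_simps)
        then show ?thesis unfolding D_def using prod_mult_ratio[of M] by blast
      qed
      have "fps_X ^ Suc M dvd B_pair k M i - 2"
        using False \<open>i \<le> k\<close> assms by (intro B_pair_low_order) auto
      then have 1: "fps_X ^ N dvd B_pair k M i - 2"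
        by (rule power_le_dvd) (use assms(3) in simp)
      have "fps_X ^ M dvd theta k N M i - ratio 0 M"
        using False \<open>i \<le> k\<close> by (intro theta_low_order) auto
      then have 2: "fps_X ^ N dvd theta k N M i - ratio 0 M"
        by (rule power_le_dvd) (use assms(3) in simp)
      show ?thesis unfolding eq by (intro dvd_diff dvd_mult 1 2)
    qed (simp add: D_def B_pair_def)
  qed (use assms in auto)
  then show ?thesis by (simp add: D_def)
qed

section \<open>The Jacobi triple product\<close>

text \<open>The q-Pascal rule serves as the definition, so no quotients are needed.\<close>

fun gauss_binomial :: "'a :: comm_ring_1 \<Rightarrow> nat \<Rightarrow> nat \<Rightarrow> 'a" where
  "gauss_binomial Q n 0 = 1"
| "gauss_binomial Q 0 (Suc r) = 0"
| "gauss_binomial Q (Suc n) (Suc r) = Q ^ Suc r * gauss_binomial Q n (Suc r) + gauss_binomial Q n r"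

text \<open>This is (Q; Q)_n, not divided by (1 - Q)^n.\<close>

definition q_fact :: "'a :: comm_ring_1 \<Rightarrow> nat \<Rightarrow> 'a" where
  "q_fact Q n = (\<Prod>j=1..n. 1 - Q ^ j)"

text \<open>The sum stops at \<open>n - 1\<close>, which gives n(n-1)/2.\<close>

definition triangle :: "nat \<Rightarrow> nat" where
  "triangle n = \<Sum>{..<n}"

lemma triangle_simps [simp]: "triangle 0 = 0" "triangle (Suc n) = triangle n + n"
  by (simp_all add: triangle_def)

lemma q_fact_simps [simp]: "q_fact Q 0 = 1" "q_fact Q (Suc n) = q_fact Q n * (1 - Q ^ Suc n)"
  by (simp_all add: q_fact_def)

lemma double_triangle: "2 * triangle n + n = n * n"
  by (induction n) auto

lemma triangle_add: "triangle (m + n) = triangle m + triangle n + m * n"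
  by (induction n) auto

lemma gauss_binomial_eq_0: "n < r \<Longrightarrow> gauss_binomial Q n r = 0"
  by (induction Q n r rule: gauss_binomial.induct) auto

lemma gauss_binomial_same: "gauss_binomial Q n n = 1"
  by (induction n) (simp_all add: gauss_binomial_eq_0)

text \<open>In the q-Pascal rule both summands are multiples of \<open>q_fact Q l\<close>, and their
  factors add up to \<open>1 - Q ^ Suc l\<close>.\<close>

lemma gauss_binomial_q_fact:
  "gauss_binomial Q (m + n) m * q_fact Q m * q_fact Q n = q_fact Q (m + n)"
proof (induction "m + n" arbitrary: m n)
  case (Suc l)
  show ?case
  proof (cases m)
    case (Suc r)
    show ?thesis
    proof (cases n)
      case 0
      then show ?thesis by (simp add: gauss_binomial_same)
    next
      case (Suc s)
      have l: "l = Suc r + s" "l = r + Suc s" using \<open>Suc l = m + n\<close> \<open>m = Suc r\<close> Suc by auto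
      have e1: "gauss_binomial Q l (Suc r) * (q_fact Q (Suc r) * q_fact Q s) = q_fact Q l"
        using Suc.hyps(1)[OF l(1)] l(1) by (simp only: mult.assoc)
      have e2: "gauss_binomial Q l r * (q_fact Q r * q_fact Q (Suc s)) = q_fact Q l"
        using Suc.hyps(1)[OF l(2)] l(2) by (simp only: mult.assoc)
      have mn: "m + n = Suc l" "m = Suc r" "n = Suc s" using \<open>Suc l = m + n\<close> \<open>m = Suc r\<close> Suc by auto
      have "gauss_binomial Q (m + n) m * q_fact Q m * q_fact Q n =
          Q ^ Suc r * (1 - Q ^ Suc s) * (gauss_binomial Q l (Suc r) * (q_fact Q (Suc r) * q_fact Q s)) +
          (1 - Q ^ Suc r) * (gauss_binomial Q l r * (q_fact Q r * q_fact Q (Suc s)))"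
        unfolding mn(1) unfolding mn(2,3) gauss_binomial.simps q_fact_simps
        by (simp only: distrib_right distrib_left ac_simps)
      also have "\<dots> = (Q ^ Suc r * (1 - Q ^ Suc s) + (1 - Q ^ Suc r)) * q_fact Q l"
        unfolding e1 e2 by (simp only: distrib_right)
      also have "Q ^ Suc r * (1 - Q ^ Suc s) + (1 - Q ^ Suc r) = 1 - Q ^ Suc l"
        using l(1) by (simp add: algebra_simps power_add)
      finally show ?thesis unfolding mn(1) q_fact_simps by (simp only: mult.commute)
    qed
  qed simp
qed simp

text \<open>Splitting off the factor \<open>y + x\<close> leaves the product for
  \<open>x * Q\<close>. The homogeneous form is kept because \<open>y\<close> is later a power of
  \<open>Q\<close>.\<close>

lemma q_binomial:
  fixes Q x y :: "'a :: comm_ring_1"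
  shows "(\<Prod>j<M. y + x * Q ^ j) =
    (\<Sum>r\<le>M. gauss_binomial Q M r * Q ^ triangle r * x ^ r * y ^ (M - r))"
proof (induction M arbitrary: x)
  case (Suc M)
  let ?f = "\<lambda>r. gauss_binomial Q M r * Q ^ triangle r * Q ^ r * x ^ r * y ^ (Suc M - r)"
  let ?g = "\<lambda>r. gauss_binomial Q M r * Q ^ triangle r * Q ^ r * x ^ Suc r * y ^ (M - r)"
  have "(\<Prod>j<Suc M. y + x * Q ^ j) = (y + x) * (\<Prod>j<M. y + (x * Q) * Q ^ j)"
    by (subst prod.lessThan_Suc_shift) (simp add: ac_simps)
  also have "\<dots> = (\<Sum>r\<le>M. y * (gauss_binomial Q M r * Q ^ triangle r * (x * Q) ^ r * y ^ (M - r))) +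
      (\<Sum>r\<le>M. x * (gauss_binomial Q M r * Q ^ triangle r * (x * Q) ^ r * y ^ (M - r)))"
    unfolding Suc.IH by (simp only: distrib_right sum_distrib_left sum.distrib)
  also have "(\<Sum>r\<le>M. y * (gauss_binomial Q M r * Q ^ triangle r * (x * Q) ^ r * y ^ (M - r))) =
      (\<Sum>r\<le>M. ?f r)"
    by (intro sum.cong) (simp_all add: Suc_diff_le power_mult_distrib ac_simps)
  \<comment> \<open>The added summand is 0, as \<open>gauss_binomial Q M (Suc M)\<close>
    vanishes.\<close>
  also have "\<dots> = (\<Sum>r\<le>Suc M. ?f r)"
    by (simp add: gauss_binomial_eq_0)
  also have "\<dots> = y ^ Suc M + (\<Sum>r\<le>M. ?f (Suc r))"
    by (subst sum.atMost_Suc_shift) simp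
  also have "(\<Sum>r\<le>M. x * (gauss_binomial Q M r * Q ^ triangle r * (x * Q) ^ r * y ^ (M - r))) =
      (\<Sum>r\<le>M. ?g r)"
    by (intro sum.cong) (simp_all add: power_mult_distrib ac_simps)
  also have "y ^ Suc M + (\<Sum>r\<le>M. ?f (Suc r)) + (\<Sum>r\<le>M. ?g r) =
      y ^ Suc M + (\<Sum>r\<le>M. ?f (Suc r) + ?g r)"
    by (simp only: sum.distrib add.assoc)
  also have "(\<Sum>r\<le>M. ?f (Suc r) + ?g r) = (\<Sum>r\<le>M. gauss_binomial Q (Suc M) (Suc r) *
      Q ^ triangle (Suc r) * x ^ Suc r * y ^ (Suc M - Suc r))"
    by (intro sum.cong) (simp_all add: power_add algebra_simps)
  also have "y ^ Suc M + \<dots> =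
      (\<Sum>r\<le>Suc M. gauss_binomial Q (Suc M) r * Q ^ triangle r * x ^ r * y ^ (Suc M - r))"
    by (subst sum.atMost_Suc_shift) simp
  finally show ?case .
qed simp

section \<open>Finite form of the triple product\<close>

lemma prod_lessThan_add:
  fixes f :: "nat \<Rightarrow> 'a :: comm_monoid_mult"
  shows "(\<Prod>j<m + n. f j) = (\<Prod>j<m. f j) * (\<Prod>j<n. f (m + j))"
  by (induction n) (simp_all add: ac_simps)

lemma sum_atMost_double:
  fixes f :: "nat \<Rightarrow> 'a :: comm_monoid_add"
  shows "(\<Sum>r\<le>N + N. f r) = (\<Sum>n\<le>N. f (N + n)) + (\<Sum>n<N. f (N - Suc n))"
proof -
  have "(\<Sum>r<N + m. f r) = (\<Sum>r<N. f r) + (\<Sum>n<m. f (N + n))" for m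
    by (induction m) (simp_all add: ac_simps)
  from this[of "Suc N"] show ?thesis
    by (simp add: lessThan_Suc_atMost sum.nat_diff_reindex add.commute)
qed

text \<open>The q-binomial theorem with \<open>2 * N\<close> factors, \<open>x = - a\<close> and
  \<open>y = Q ^ N\<close>: the upper half of the product gives the factors with \<open>a\<close>,
  the lower half those with \<open>b\<close>. The sum is split at its middle index.\<close>

lemma finite_triple_product:
  fixes a b Q :: "'a :: idom"
  assumes "Q = a * b" "Q \<noteq> 0"
  shows "(\<Prod>j<N. 1 - a * Q ^ j) * (\<Prod>j<N. 1 - b * Q ^ j) =
    (\<Sum>n\<le>N. gauss_binomial Q (N + N) (N + n) * ((- a) ^ n * Q ^ triangle n)) +
    (\<Sum>n<N. gauss_binomial Q (N + N) (N - Suc n) * ((- b) ^ Suc n * Q ^ triangle (Suc n)))"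
    (is "?L = ?R")
proof -
  \<comment> \<open>\<open>K\<close> collects what is pulled out of the two halves; it is nonzero
    and is cancelled at the end.\<close>
  define K where "K = (- a) ^ N * Q ^ triangle N * Q ^ (N * N)"
  have K0: "K \<noteq> 0" using assms by (auto simp: K_def)
  have low: "(\<Prod>j<N. Q ^ N + (- a) * Q ^ j) = (- a) ^ N * Q ^ triangle N * (\<Prod>j<N. 1 - b * Q ^ j)"
  proof -
    have "(\<Prod>j<N. Q ^ N + (- a) * Q ^ j) = (\<Prod>j<N. (- a) * Q ^ j * (1 - b * Q ^ (N - Suc j)))"
    proof (intro prod.cong refl)
      fix j assume "j \<in> {..<N}"
      then have "N = j + 1 + (N - Suc j)" by simp
      \<comment> \<open>Since \<open>Q = a * b\<close>, the power \<open>Q ^ N\<close> is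
        \<open>a * Q ^ j\<close> times \<open>b * Q ^ (N - Suc j)\<close>.\<close>
      then have "Q ^ N = Q ^ j * Q * Q ^ (N - Suc j)"
        by (metis power_add power_one_right)
      also have "\<dots> = a * b * (Q ^ j * Q ^ (N - Suc j))" using assms(1) by (simp add: ac_simps)
      finally show "Q ^ N + (- a) * Q ^ j = (- a) * Q ^ j * (1 - b * Q ^ (N - Suc j))"
        by (simp add: algebra_simps)
    qed
    also have "\<dots> = (\<Prod>j<N. (- a) * Q ^ j) * (\<Prod>j<N. 1 - b * Q ^ (N - Suc j))"
      by (rule prod.distrib)
    also have "(\<Prod>j<N. (- a) * Q ^ j) = (- a) ^ N * Q ^ triangle N"
      unfolding triangle_def prod.distrib by (simp add: power_sum)
    also have "(\<Prod>j<N. 1 - b * Q ^ (N - Suc j)) = (\<Prod>j<N. 1 - b * Q ^ j)"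
      by (rule prod.nat_diff_reindex)
    finally show ?thesis .
  qed
  have high: "(\<Prod>j<N. Q ^ N + (- a) * Q ^ (N + j)) = Q ^ (N * N) * (\<Prod>j<N. 1 - a * Q ^ j)"
  proof -
    have "(\<Prod>j<N. Q ^ N + (- a) * Q ^ (N + j)) = (\<Prod>j<N. Q ^ N * (1 - a * Q ^ j))"
      by (intro prod.cong) (simp_all add: algebra_simps power_add)
    then show ?thesis by (simp add: prod.distrib power_mult)
  qed
  have "K * ?L = (\<Prod>j<N + N. Q ^ N + (- a) * Q ^ j)"
    unfolding prod_lessThan_add low high K_def by (simp only: ac_simps)
  also have "\<dots> = (\<Sum>n\<le>N. gauss_binomial Q (N + N) (N + n) * Q ^ triangle (N + n) *
      (- a) ^ (N + n) * (Q ^ N) ^ (N + N - (N + n))) +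
    (\<Sum>n<N. gauss_binomial Q (N + N) (N - Suc n) * Q ^ triangle (N - Suc n) *
      (- a) ^ (N - Suc n) * (Q ^ N) ^ (N + N - (N - Suc n)))"
    unfolding q_binomial sum_atMost_double ..
  also have "\<dots> = K * ?R"
    unfolding distrib_left[of K] sum_distrib_left
  proof (intro arg_cong2[where f = "(+)"] sum.cong refl)
    fix n assume "n \<in> {..N}"
    then obtain t where t: "N = t + n" by (metis atMost_iff le_Suc_ex add.commute)
    have "triangle (N + n) + N * (N + N - (N + n)) = triangle N + N * N + triangle n"
      unfolding triangle_add by (simp add: t algebra_simps)
    then have "Q ^ triangle (N + n) * (Q ^ N) ^ (N + N - (N + n)) =
        Q ^ triangle N * Q ^ (N * N) * Q ^ triangle n"
      by (simp only: power_mult[symmetric] power_add[symmetric])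
    then have "gauss_binomial Q (N + N) (N + n) * (- a) ^ (N + n) *
        (Q ^ triangle (N + n) * (Q ^ N) ^ (N + N - (N + n))) =
      K * (gauss_binomial Q (N + N) (N + n) * ((- a) ^ n * Q ^ triangle n))"
      unfolding K_def power_add[of "- a"] by (simp only: ac_simps)
    then show "gauss_binomial Q (N + N) (N + n) * Q ^ triangle (N + n) *
        (- a) ^ (N + n) * (Q ^ N) ^ (N + N - (N + n)) =
      K * (gauss_binomial Q (N + N) (N + n) * ((- a) ^ n * Q ^ triangle n))"
      by (simp only: ac_simps)
  next
    fix n assume "n \<in> {..<N}"
    define s where "s = Suc n"
    obtain t where t: "N = t + s"
      using \<open>n \<in> {..<N}\<close> by (metis s_def Suc_leI lessThan_iff le_Suc_ex add.commute)
    \<comment> \<open>This trades the \<open>s\<close> missing factors \<open>- a\<close> for powers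
      of \<open>- b\<close>.\<close>
    have "(- a) ^ s * (- b) ^ s = Q ^ s"
      by (simp add: assms(1) power_mult_distrib[symmetric])
    moreover have "Q ^ triangle t * Q ^ (N * (N + s)) = Q ^ s * (Q ^ triangle N * Q ^ (N * N) * Q ^ triangle s)"
    proof -
      have "triangle t + N * (N + s) = s + (triangle N + N * N + triangle s)"
        using double_triangle[of s] unfolding t triangle_add by (simp add: algebra_simps)
      then show ?thesis by (simp only: power_add[symmetric] add.assoc)
    qed
    ultimately have "gauss_binomial Q (N + N) t * (- a) ^ t * (Q ^ triangle t * Q ^ (N * (N + s))) =
        gauss_binomial Q (N + N) t * (- a) ^ t *
          ((- a) ^ s * (- b) ^ s * (Q ^ triangle N * Q ^ (N * N) * Q ^ triangle s))"
      by (simp only:)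
    also have "\<dots> = K * (gauss_binomial Q (N + N) t * ((- b) ^ s * Q ^ triangle s))"
      unfolding K_def t power_add[of "- a"] by (simp only: ac_simps)
    finally have "gauss_binomial Q (N + N) t * Q ^ triangle t * (- a) ^ t * (Q ^ N) ^ (N + s) =
        K * (gauss_binomial Q (N + N) t * ((- b) ^ s * Q ^ triangle s))"
      unfolding power_mult[symmetric] by (simp only: ac_simps)
    moreover have "N - Suc n = t" "N + N - (N - Suc n) = N + s" using t s_def by auto
    ultimately show "gauss_binomial Q (N + N) (N - Suc n) * Q ^ triangle (N - Suc n) *
        (- a) ^ (N - Suc n) * (Q ^ N) ^ (N + N - (N - Suc n)) =
      K * (gauss_binomial Q (N + N) (N - Suc n) * ((- b) ^ Suc n * Q ^ triangle (Suc n)))"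
      by (simp only: s_def)
  qed
  finally show ?thesis using K0 by simp
qed

section \<open>Passage to the limit modulo powers of q\<close>

lemma q_fact_cong:
  fixes Q :: "'a :: comm_ring_1"
  assumes "s \<le> M"
  shows "Q ^ Suc s dvd q_fact Q M - q_fact Q s"
  using assms
proof (induction M rule: dec_induct)
  case (step M)
  have "q_fact Q (Suc M) - q_fact Q s = (q_fact Q M - q_fact Q s) - q_fact Q M * Q ^ Suc M"
    by (simp add: algebra_simps)
  moreover have "Q ^ Suc s dvd Q ^ Suc M" using step.hyps by (intro le_imp_power_dvd) simp
  ultimately show ?case using step.IH by (metis dvd_diff dvd_mult)
qed simp

text \<open>The binomial is a quotient of values of \<open>q_fact\<close> at \<open>N + N\<close>,
  \<open>N + n\<close> and \<open>N - n\<close>. By \<open>q_fact_cong\<close> these and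
  \<open>q_fact Q N\<close> all agree modulo \<open>Q ^ Suc (N - n)\<close>, so they cancel after
  multiplication by the unit \<open>q_fact Q (N - n)\<close>.\<close>

lemma gauss_binomial_limit:
  fixes N n c :: nat
  defines "Q \<equiv> (fps_X :: real fps) ^ c"
  assumes "n \<le> N" "c \<ge> 1" and r: "r = N + n \<or> r = N - n"
  shows "Q ^ Suc (N - n) dvd q_fact Q N * gauss_binomial Q (N + N) r - 1"
proof -
  let ?g = "gauss_binomial Q (N + N) r"
  have g: "?g * q_fact Q (N + n) * q_fact Q (N - n) = q_fact Q (N + N)"
    using r
  proof
    assume "r = N + n"
    then show ?thesis using gauss_binomial_q_fact[of Q "N + n" "N - n"] assms(2) by simp
  next
    assume "r = N - n"
    then show ?thesis using gauss_binomial_q_fact[of Q "N - n" "N + n"] assms(2)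
      by (simp add: ac_simps)
  qed
  have "q_fact Q (N - n) * (q_fact Q N * ?g - 1) =
      ?g * q_fact Q (N - n) * ((q_fact Q N - q_fact Q (N - n)) - (q_fact Q (N + n) - q_fact Q (N - n))) +
      (q_fact Q (N + N) - q_fact Q (N - n))"
    unfolding g[symmetric] by (simp add: algebra_simps)
  also have "Q ^ Suc (N - n) dvd \<dots>"
    by (intro dvd_add dvd_mult dvd_diff q_fact_cong) auto
  finally have "fps_X ^ (c * Suc (N - n)) dvd q_fact Q (N - n) * (q_fact Q N * ?g - 1)"
    unfolding Q_def power_mult .
  moreover have "q_fact Q (N - n) $ 0 \<noteq> 0"
    using assms(3) prod_one_minus_X_nth_0[of "{1..N - n}" "\<lambda>j. c * j"]
    by (simp add: q_fact_def Q_def power_mult[symmetric])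
  ultimately have "fps_X ^ (c * Suc (N - n)) dvd q_fact Q N * ?g - 1"
    by (rule fps_X_power_dvd_unit_cancel[rotated])
  then show ?thesis unfolding Q_def power_mult .
qed

text \<open>With a = q^i and b = q^(2k-i) the finite triple product has the same powers as the
  series \<open>theta\<close> at \<open>m = 0\<close>, where \<open>ratio\<close> is 1.\<close>

lemma theta_triple_product:
  assumes "1 \<le> i" "i < k"
  defines "Q \<equiv> (fps_X :: real fps) ^ (2 * k)"
  shows "fps_X ^ N dvd theta k N 0 i -
    q_fact Q N * ((\<Prod>j<N. 1 - fps_X ^ i * Q ^ j) * (\<Prod>j<N. 1 - fps_X ^ (2 * k - i) * Q ^ j))"
proof -
  let ?a = "(fps_X :: real fps) ^ i" and ?b = "(fps_X :: real fps) ^ (2 * k - i)"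
  define A where "A = (\<lambda>n. (- ?a) ^ n * Q ^ triangle n)"
  define B where "B = (\<lambda>n. (- ?b) ^ n * Q ^ triangle n)"
  define g where "g = gauss_binomial Q (N + N)"
  have Qab: "Q = ?a * ?b" using assms by (simp add: power_add[symmetric])
  have Q0: "Q \<noteq> 0" by (simp add: Q_def)
  have product: "(\<Prod>j<N. 1 - ?a * Q ^ j) * (\<Prod>j<N. 1 - ?b * Q ^ j) =
      (\<Sum>n\<le>N. g (N + n) * A n) + (\<Sum>n<N. g (N - Suc n) * B (Suc n))"
    unfolding A_def B_def g_def by (rule finite_triple_product[OF Qab Q0])
  have Xpow: "(fps_X :: real fps) ^ N dvd fps_X ^ (2 * k * e)" if "N \<le> e" for e
  proof -
    have "1 * N \<le> 2 * k * e" using assms that by (intro mult_mono) auto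
    then show ?thesis by (simp add: le_imp_power_dvd)
  qed
  \<comment> \<open>The coefficient is exact up to order \<open>Suc (N - n)\<close> in
    \<open>Q\<close>, and \<open>C\<close> contributes \<open>triangle n \<ge> n - 1\<close>, so
    together the order is at least \<open>N\<close>.\<close>
  have error: "fps_X ^ N dvd (q_fact Q N * g r - 1) * C"
    if "n \<le> N" "r = N + n \<or> r = N - n" "Q ^ triangle n dvd C" for n r C
  proof -
    have "n \<le> Suc (triangle n)" by (cases n) auto
    then have "N \<le> Suc (N - n) + triangle n" using that(1) by linarith
    then have "fps_X ^ N dvd Q ^ (Suc (N - n) + triangle n)"
      unfolding Q_def power_mult[symmetric] by (rule Xpow)
    also have "\<dots> dvd (q_fact Q N * g r - 1) * C"
      unfolding power_add g_def Q_def
      by (intro mult_dvd_mono gauss_binomial_limit that[unfolded Q_def]) (use assms in auto)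
    finally show ?thesis .
  qed
  \<comment> \<open>The two powers in a term belong to opposite sides of the two-sided series, with
    a shift by one on the \<open>A\<close> side.\<close>
  have "theta_term k 0 i n = B n + A (Suc n)" for n
  proof -
    have eB: "(2 * k - i) * n + 2 * k * triangle n = k * n * n + (k - i) * n"
    proof -
      obtain d where d: "k = i + d" using assms(2) less_imp_add_positive by blast
      have "k * (2 * triangle n + n) = k * (n * n)" unfolding double_triangle ..
      then show ?thesis unfolding d by (simp add: algebra_simps)
    qed
    have eA: "i * Suc n + 2 * k * triangle (Suc n) = k * n * n + k * n + i * n + i"
    proof -
      have "k * (2 * triangle n + n) = k * (n * n)" unfolding double_triangle ..
      then show ?thesis by (simp add: algebra_simps)
    qed
    have "B n = (-1) ^ n * fps_X ^ (k * n * n + (k - i) * n)"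
      unfolding B_def Q_def power_minus[of ?b] eB[symmetric]
      by (simp add: power_mult[symmetric] power_add mult.assoc)
    moreover have "A (Suc n) = - ((-1) ^ n * fps_X ^ (k * n * n + k * n + i * n + i))"
      unfolding A_def Q_def power_minus[of ?a] eA[symmetric]
      by (simp only: power_mult[symmetric] power_add[symmetric] mult.assoc) simp
    ultimately show ?thesis by (simp add: theta_term_def algebra_simps)
  qed
  then have "theta k N 0 i = (\<Sum>n<Suc N. B n) + (\<Sum>n<Suc N. A (Suc n))"
    by (simp only: theta_def sum.distrib lessThan_Suc_atMost)
  also have "(\<Sum>n<Suc N. B n) = 1 + (\<Sum>n<N. B (Suc n))"
    unfolding sum.lessThan_Suc_shift by (simp add: B_def)
  \<comment> \<open>The truncation of \<open>theta\<close> contains one extra term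
    \<open>A (Suc N)\<close>; the \<open>- 1\<close> removes \<open>A 0\<close> and cancels against
    \<open>B 0\<close>.\<close>
  also have "(\<Sum>n<Suc N. A (Suc n)) = (\<Sum>n\<le>N. A n) + A (Suc N) - 1"
    using sum.lessThan_Suc_shift[of A "Suc N"] by (simp add: A_def lessThan_Suc_atMost)
  finally have eq: "theta k N 0 i - q_fact Q N * ((\<Prod>j<N. 1 - ?a * Q ^ j) * (\<Prod>j<N. 1 - ?b * Q ^ j)) =
      A (Suc N) - ((\<Sum>n\<le>N. (q_fact Q N * g (N + n) - 1) * A n) +
        (\<Sum>n<N. (q_fact Q N * g (N - Suc n) - 1) * B (Suc n)))"
    unfolding product
    by (simp add: left_diff_distrib sum_subtractf distrib_left sum_distrib_left mult.assoc)
  show ?thesis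
    unfolding eq
  proof (intro dvd_diff dvd_add dvd_sum)
    show "fps_X ^ N dvd A (Suc N)"
      unfolding A_def Q_def power_mult[symmetric] by (intro dvd_mult Xpow) simp
    show "fps_X ^ N dvd (q_fact Q N * g (N + n) - 1) * A n" if "n \<in> {..N}" for n
      using that by (intro error[of n]) (auto simp: A_def)
    show "fps_X ^ N dvd (q_fact Q N * g (N - Suc n) - 1) * B (Suc n)" if "n \<in> {..<N}" for n
      using that by (intro error[of "Suc n"]) (auto simp: B_def simp del: triangle_simps)
  qed
qed

section \<open>Comparison of the generating functions\<close>

text \<open>The residue of -i is represented by \<open>2 * k - i\<close>.\<close>

definition excluded :: "nat \<Rightarrow> nat \<Rightarrow> nat set" where
  "excluded k i = {j. j mod (2 * k) \<in> {0, i, 2 * k - i}}"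

text \<open>A block of \<open>2 * k\<close> consecutive numbers adds one element for each of the
  three residues; residue 0 is met at its right end.\<close>

lemma excluded_block:
  assumes "1 \<le> i" "i < k"
  shows "{1..2 * k * Suc N} \<inter> excluded k i =
    insert (2 * k * N + i) (insert (2 * k * N + (2 * k - i)) (insert (2 * k * Suc N)
      ({1..2 * k * N} \<inter> excluded k i)))" (is "?L = ?R")
proof (intro equalityI subsetI)
  fix j assume j: "j \<in> ?L"
  show "j \<in> ?R"
  proof (cases "j \<le> 2 * k * N")
    case False
    define t where "t = j - 2 * k * N"
    have t: "j = 2 * k * N + t" "1 \<le> t" "t \<le> 2 * k" using False j by (auto simp: t_def)
    have "j mod (2 * k) = t mod (2 * k)" unfolding t(1) by simp
    moreover have "t mod (2 * k) = (if t = 2 * k then 0 else t)" using t(3) by simp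
    ultimately show ?thesis using j t by (auto simp: excluded_def split: if_splits)
  qed (use j in auto)
next
  fix j assume "j \<in> ?R"
  then consider "j = 2 * k * N + i" | "j = 2 * k * N + (2 * k - i)" | "j = 2 * k * Suc N"
    | "j \<in> {1..2 * k * N} \<inter> excluded k i" by blast
  then show "j \<in> ?L"
  proof cases
    case 1
    then show ?thesis using assms by (simp add: excluded_def)
  next
    case 2
    have "(2 * k * N + (2 * k - i)) mod (2 * k) = (2 * k - i) mod (2 * k)" by simp
    also have "\<dots> = 2 * k - i" using assms by simp
    finally have "j \<in> excluded k i" unfolding 2 excluded_def by simp
    moreover have "1 \<le> 2 * k - i" "2 * k - i \<le> 2 * k" using assms by auto
    then have "1 \<le> j" "j \<le> 2 * k * Suc N" unfolding 2 mult_Suc_right by linarith+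
    ultimately show ?thesis by simp
  next
    case 3
    have "(2 * k * Suc N) mod (2 * k) = 0" by (rule mod_mult_self1_is_0)
    then show ?thesis using 3 assms unfolding excluded_def by auto
  next
    case 4
    then show ?thesis by auto
  qed
qed

text \<open>Each block contributes one factor to each of the three products, which are distinct
  since \<open>0 < i < k\<close>.\<close>

lemma prod_excluded:
  assumes "1 \<le> i" "i < k"
  defines "Q \<equiv> (fps_X :: real fps) ^ (2 * k)"
  shows "(\<Prod>j\<in>{1..2 * k * N} \<inter> excluded k i. 1 - fps_X ^ j) =
    q_fact Q N * ((\<Prod>j<N. 1 - fps_X ^ i * Q ^ j) * (\<Prod>j<N. 1 - fps_X ^ (2 * k - i) * Q ^ j))"
proof (induction N)
  case (Suc N)
  let ?S = "{1..2 * k * N} \<inter> excluded k i"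
  let ?f = "\<lambda>j. 1 - (fps_X :: real fps) ^ j"
  have new: "2 * k * N + i \<notin> insert (2 * k * N + (2 * k - i)) (insert (2 * k * Suc N) ?S)"
    "2 * k * N + (2 * k - i) \<notin> insert (2 * k * Suc N) ?S" "2 * k * Suc N \<notin> ?S"
    using assms(1,2) by auto
  have "prod ?f ({1..2 * k * Suc N} \<inter> excluded k i) =
      ?f (2 * k * N + i) * (?f (2 * k * N + (2 * k - i)) * (?f (2 * k * Suc N) * prod ?f ?S))"
    unfolding excluded_block[OF assms(1,2)] using new by (subst prod.insert; simp)+
  also have "\<dots> = (1 - fps_X ^ i * Q ^ N) * ((1 - fps_X ^ (2 * k - i) * Q ^ N) *
      ((1 - Q ^ Suc N) * prod ?f ?S))"
    unfolding Q_def power_mult[symmetric] power_add[symmetric] by (simp only: add.commute)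
  finally show ?case unfolding Suc.IH q_fact_simps prod.lessThan_Suc by (simp only: ac_simps)
qed simp

lemma B_pair_eq_superpartitions:
  assumes "1 \<le> i" "i < k"
  shows "B_pair k 0 i = gen_fun (S_from (- excluded k i) 0)"
proof -
  let ?A = "- excluded k i"
  have A0: "0 \<notin> ?A" by (simp add: excluded_def)
  have "fps_X ^ N dvd B_pair k 0 i - gen_fun (S_from ?A 0)" for N
  proof -
    \<comment> \<open>A whole number of blocks, so that \<open>prod_excluded\<close> applies, and at
      least \<open>N\<close>.\<close>
    let ?M = "2 * k * N"
    define U where "U = (\<Prod>j=1..?M. 1 - fps_X ^ j :: real fps)"
    define P where "P = (\<Prod>j=1..?M. 1 + fps_X ^ j :: real fps)"
    define Ua where "Ua = (\<Prod>j\<in>{1..?M} \<inter> ?A. 1 - fps_X ^ j :: real fps)"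
    define Ub where "Ub = (\<Prod>j\<in>{1..?M} \<inter> excluded k i. 1 - fps_X ^ j :: real fps)"
    define C where "C = gen_fun (S_from ?A 1)"
    define E where "E = gen_fun (S_from ?A (Suc ?M))"
    define t where "t = theta k N 0 i"
    have "1 * N \<le> ?M" using assms by (intro mult_mono) auto
    then have NM: "N \<le> ?M" by simp
    have "{1..?M} = ({1..?M} \<inter> ?A) \<union> ({1..?M} \<inter> excluded k i)" by blast
    then have U: "U = Ua * Ub"
      unfolding U_def Ua_def Ub_def by (metis (no_types, lifting) Int_Diff Compl_eq_Diff_UNIV
        prod.Int_Diff finite_atLeastAtMost Diff_eq mult.commute)
    \<comment> \<open>The factor 2 accounts for the optional overlined 0.\<close>
    have C0: "gen_fun (S_from ?A 0) = 2 * C"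
      using gen_fun_S_from[OF A0, of 0] A0 by (simp add: C_def)
    have CE: "C * Ua = P * E"
      unfolding C_def Ua_def P_def E_def by (rule gen_fun_S_from_prod[OF A0])
    have d1: "fps_X ^ N dvd U * B_pair k 0 i - 2 * P * t"
      unfolding U_def P_def t_def using assms NM by (intro B_pair_eq_theta) auto
    have d2: "fps_X ^ N dvd t - Ub"
      unfolding t_def Ub_def prod_excluded[OF assms] by (rule theta_triple_product[OF assms])
    have "fps_X ^ Suc ?M dvd E - 1"
      unfolding E_def
      by (rule gen_fun_large_parts) (auto simp: S_from_def nonincreasing_def overlined_first_def)
    then have d3: "fps_X ^ N dvd E - 1"
      using NM by (meson dvd_trans le_imp_power_dvd le_SucI)
    \<comment> \<open>Modulo q^N both products with \<open>U\<close> reduce to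
      \<open>2 * P * Ub\<close>: the first through \<open>t\<close>, the second because
      \<open>C * Ua = P * E\<close> and \<open>E\<close> is close to 1.\<close>
    have "U * (B_pair k 0 i - gen_fun (S_from ?A 0)) =
        (U * B_pair k 0 i - 2 * P * t) + 2 * P * (t - Ub) - 2 * Ub * P * (E - 1)"
    proof -
      have "U * gen_fun (S_from ?A 0) = 2 * Ub * (C * Ua)"
        unfolding U C0 by (simp only: ac_simps)
      also have "\<dots> = 2 * Ub * P * E" unfolding CE by (simp only: ac_simps)
      finally show ?thesis by (simp add: algebra_simps)
    qed
    also have "fps_X ^ N dvd \<dots>" 
      by (rule dvd_diff[OF dvd_add[OF d1 dvd_mult[OF d2]] dvd_mult[OF d3]])
    finally have "fps_X ^ N dvd U * (B_pair k 0 i - gen_fun (S_from ?A 0))" .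
    moreover have "U $ 0 \<noteq> 0"
      using prod_one_minus_X_nth_0[of "{1..?M}" "\<lambda>j. j"] by (simp add: U_def)
    ultimately show ?thesis by (rule fps_X_power_dvd_unit_cancel[rotated])
  qed
  then have "(B_pair k 0 i - gen_fun (S_from ?A 0)) $ n = 0" for n
    using fps_X_power_dvd_iff_nth[of "Suc n"] by blast
  then show ?thesis by (simp add: fps_eq_iff)
qed

section \<open>Translation to integer congruences and conclusion\<close>

lemma excluded_iff_cong:
  assumes "1 \<le> i" "i < k"
  shows "s \<in> excluded k i \<longleftrightarrow> [int s = 0] (mod (2 * int k)) \<or>
    [int s = int i] (mod (2 * int k)) \<or> [int s = - int i] (mod (2 * int k))"
proof -
  have c: "[int s = int t] (mod (2 * int k)) \<longleftrightarrow> s mod (2 * k) = t" if "t < 2 * k" for t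
    using that cong_int_iff[of s t "2 * k"] by (simp add: cong_def)
  have "[int s = - int i] (mod (2 * int k)) \<longleftrightarrow> [int s = int (2 * k - i)] (mod (2 * int k))"
  proof -
    have "[- int i = int (2 * k - i)] (mod (2 * int k))"
      using assms by (simp add: of_nat_diff cong_iff_dvd_diff)
    then show ?thesis using cong_trans cong_sym by blast
  qed
  then show ?thesis using c[of 0] c[of i] c[of "2 * k - i"] assms by (simp add: excluded_def)
qed

theorem theorem7p2:
  fixes k i n :: nat
  assumes "k \<ge> 2" and "1 \<le> i" and "i \<le> k - 1"
  shows "Bbar k i n + Bbar k (i + 1) n =
    card {xs. superpartition n xs \<and>
      (\<forall>p\<in>set xs. \<not> overlined p \<longrightarrow>
         \<not> [int (size_of p) = 0] (mod (2 * int k)) \<and>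
         \<not> [int (size_of p) = int i] (mod (2 * int k)) \<and>
         \<not> [int (size_of p) = - int i] (mod (2 * int k)))}"
    (is "_ = card ?S")
proof -
  have ik: "1 \<le> i" "i < k" using assms by auto
  \<comment> \<open>Positivity of the non-overlined parts is thus encoded in the complement of
    \<open>excluded\<close>.\<close>
  have "0 \<in> excluded k i" by (simp add: excluded_def)
  then have part: "s \<in> - excluded k i \<longleftrightarrow> 0 < s \<and> \<not> [int s = 0] (mod (2 * int k)) \<and>
      \<not> [int s = int i] (mod (2 * int k)) \<and> \<not> [int s = - int i] (mod (2 * int k))" for s
    using excluded_iff_cong[OF ik, of s] by (cases "s = 0") auto
  have "?S = {xs \<in> S_from (- excluded k i) 0. parts_sum xs = n}"
    unfolding S_from_def superpartition_iff
    by (simp only: part le0) blast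
  then have "real (card ?S) = gen_fun (S_from (- excluded k i) 0) $ n"
    by (simp only: gen_fun_nth)
  also have "\<dots> = B_pair k 0 i $ n"
    by (simp only: B_pair_eq_superpartitions[OF ik])
  also have "\<dots> = real (card (Bset k i n)) + real (card (Bset k (i + 1) n))"
    using ik by (simp add: B_pair_def gen_fun_nth Bset_eq_B_from)
  finally show ?thesis unfolding Bbar_def by linarith
qed

end
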